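(* Let $T>0$ and let $(\Omega,(\mathcal{F}_t)_{t\in[0,T]},P)$ be a filtered probability space satisfying the usual conditions, with $\mathcal{F}_0$ trivial and $\mathcal{F}=\mathcal{F}_T$. Let $n\ge 1$, $\delta\in(0,1)$ and \[ \mathcal{O}=\Big\{x\in(0,\infty)^n:\ \max_{j}\frac{x_j}{x_1+\cdots+x_n}<1-\delta\Big\}. \] Let $S=(S(t))_{t\in[0,T]}$ be a continuous adapted process taking values in $\mathcal{O}$ which has conditional full support in $\mathcal{O}$. Then for every $\varepsilon>0$ there exists an $\varepsilon$-consistent price system $(\tilde S,Q)$ to $S$ such that $\tilde S$ takes values in $\mathcal{O}$.
   Context: Conditional full support: for an open set $\mathcal{O}\subset\mathbb{R}^n$ and a continuous adapted $\mathcal{O}$-valued process $(S(t))_{t\in[0,T]}$, we say $S$ has conditional full support in $\mathcal{O}$ if for all $t\in[0,T]$ and every open set $G\subset C([0,T],\mathcal{O})$ (topology of uniform convergence), $P(S\in G\mid\mathcal{F}_t)>0$ almost surely on the event $\{S|_{[0,t]}\in\{g|_{[0,t]}: g\in G\}\}$. An $\varepsilon$-consistent price system to $S$ is a pair $(\tilde S,Q)$ where $Q$ is a probability measure equivalent to $P$ and $\tilde S$ is a $Q$-martingale in the filtration $(\mathcal{F}_t)$ (not required to be continuous) such that $\frac{1}{1+\varepsilon}\le \tilde S_i(t)/S_i(t)\le 1+\varepsilon$ almost surely for all $t\in[0,T]$ and $i=1,\dots,n$. *)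

theory Defs
  imports "HOL-Probability.Probability"
begin

definition O_set :: "real \<Rightarrow> (real ^ 'n::finite) set" where
  "O_set \<delta> = {x. (\<forall>j. 0 < x $ j) \<and>
       Max (range (\<lambda>j. x $ j / (\<Sum>i\<in>UNIV. x $ i))) < 1 - \<delta>}"

definition usual_filtered_space :: "'a measure \<Rightarrow> (real \<Rightarrow> 'a measure) \<Rightarrow> real \<Rightarrow> bool" where
  "usual_filtered_space M F T \<longleftrightarrow>
     prob_space M \<and>
     (\<forall>t\<in>{0..T}. subalgebra M (F t)) \<and>
     (\<forall>s t. 0 \<le> s \<and> s \<le> t \<and> t \<le> T \<longrightarrow> sets (F s) \<subseteq> sets (F t)) \<and>
     \<comment> \<open>completeness: F_0 contains all subsets of P-null sets\<close>
     (\<forall>N. N \<subseteq> space M \<and> (\<exists>A\<in>sets M. N \<subseteq> A \<and> emeasure M A = 0) \<longrightarrow> N \<in> sets (F 0)) \<and>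
     \<comment> \<open>right continuity\<close>
     (\<forall>t\<in>{0..<T}. sets (F t) = (\<Inter>s\<in>{t<..T}. sets (F s))) \<and>
     \<comment> \<open>F_0 trivial\<close>
     (\<forall>A\<in>sets (F 0). measure M A = 0 \<or> measure M A = 1) \<and>
     \<comment> \<open>F = F_T\<close>
     sets M = sets (F T)"

text \<open>Open subsets of C([0,T],O) with the topology of uniform convergence.
  A path is represented by a function real => real^'n of which only the
  restriction to [0,T] matters.\<close>
definition path_space :: "real \<Rightarrow> (real ^ 'n::finite) set \<Rightarrow> (real \<Rightarrow> real ^ 'n) set" where
  "path_space T Ob = {g. continuous_on {0..T} g \<and> (\<forall>t\<in>{0..T}. g t \<in> Ob)}"

definition uniform_open :: "real \<Rightarrow> (real ^ 'n::finite) set \<Rightarrow> (real \<Rightarrow> real ^ 'n) set \<Rightarrow> bool" where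
  "uniform_open T Ob G \<longleftrightarrow> G \<subseteq> path_space T Ob \<and>
     (\<forall>g\<in>G. \<exists>e>0. \<forall>h\<in>path_space T Ob.
        (\<forall>t\<in>{0..T}. dist (h t) (g t) < e) \<longrightarrow> (\<exists>g'\<in>G. \<forall>t\<in>{0..T}. g' t = h t))"

definition path_event :: "'a measure \<Rightarrow> real \<Rightarrow> (real \<Rightarrow> 'a \<Rightarrow> real ^ 'n::finite) \<Rightarrow> (real \<Rightarrow> real ^ 'n) set \<Rightarrow> 'a set" where
  "path_event M T S G = {\<omega>\<in>space M. \<exists>g\<in>G. \<forall>t\<in>{0..T}. g t = S t \<omega>}"

definition cont_adapted_process :: "'a measure \<Rightarrow> (real \<Rightarrow> 'a measure) \<Rightarrow> real \<Rightarrow> (real ^ 'n::finite) set \<Rightarrow> (real \<Rightarrow> 'a \<Rightarrow> real ^ 'n) \<Rightarrow> bool" where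
  "cont_adapted_process M F T Ob S \<longleftrightarrow>
     (\<forall>t\<in>{0..T}. S t \<in> borel_measurable (F t)) \<and>
     (\<forall>\<omega>\<in>space M. continuous_on {0..T} (\<lambda>t. S t \<omega>)) \<and>
     (\<forall>t\<in>{0..T}. \<forall>\<omega>\<in>space M. S t \<omega> \<in> Ob)"

definition cond_full_support :: "'a measure \<Rightarrow> (real \<Rightarrow> 'a measure) \<Rightarrow> real \<Rightarrow> (real ^ 'n::finite) set \<Rightarrow> (real \<Rightarrow> 'a \<Rightarrow> real ^ 'n) \<Rightarrow> bool" where
  "cond_full_support M F T Ob S \<longleftrightarrow>
     (\<forall>t\<in>{0..T}. \<forall>G. uniform_open T Ob G \<longrightarrow>
        (AE \<omega> in M. (\<exists>g\<in>G. \<forall>s\<in>{0..t}. g s = S s \<omega>) \<longrightarrow>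
            real_cond_exp M (F t) (indicator (path_event M T S G)) \<omega> > 0))"

definition equiv_prob :: "'a measure \<Rightarrow> 'a measure \<Rightarrow> bool" where
  "equiv_prob M Q \<longleftrightarrow> prob_space Q \<and> space Q = space M \<and> sets Q = sets M \<and>
     (\<forall>A\<in>sets M. emeasure M A = 0 \<longleftrightarrow> emeasure Q A = 0)"

definition is_martingale :: "'a measure \<Rightarrow> (real \<Rightarrow> 'a measure) \<Rightarrow> real \<Rightarrow> (real \<Rightarrow> 'a \<Rightarrow> real ^ 'n::finite) \<Rightarrow> bool" where
  "is_martingale Q F T St \<longleftrightarrow>
     (\<forall>t\<in>{0..T}. St t \<in> borel_measurable (F t)) \<and>
     (\<forall>t\<in>{0..T}. \<forall>i. integrable Q (\<lambda>\<omega>. St t \<omega> $ i)) \<and>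
     (\<forall>s t i. 0 \<le> s \<and> s \<le> t \<and> t \<le> T \<longrightarrow>
        (\<forall>A\<in>sets (F s). (\<integral>\<omega>. indicator A \<omega> * St t \<omega> $ i \<partial>Q) = (\<integral>\<omega>. indicator A \<omega> * St s \<omega> $ i \<partial>Q)))"

definition eps_cps :: "'a measure \<Rightarrow> (real \<Rightarrow> 'a measure) \<Rightarrow> real \<Rightarrow> real \<Rightarrow> (real \<Rightarrow> 'a \<Rightarrow> real ^ 'n::finite) \<Rightarrow> (real \<Rightarrow> 'a \<Rightarrow> real ^ 'n) \<Rightarrow> 'a measure \<Rightarrow> bool" where
  "eps_cps M F T \<epsilon> S St Q \<longleftrightarrow>
     equiv_prob M Q \<and> is_martingale Q F T St \<and>
     (AE \<omega> in M. \<forall>t\<in>{0..T}. \<forall>i.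
        1 / (1 + \<epsilon>) \<le> St t \<omega> $ i / S t \<omega> $ i \<and> St t \<omega> $ i / S t \<omega> $ i \<le> 1 + \<epsilon>)"

end

theory Submission
  imports Defs
begin

text \<open>
  The argument works for every open subset of the positive orthant. The path is sampled at the successive
  times at which it leaves a small sup-norm cube, of radius proportional to the distance of its centre from the
  complement of the open set. The next centre is the old one plus the radius times
  a displacement in \<open>{-1, 0, 1}\<^sup>n\<close>, obtained by rounding the exit point; displacement \<open>0\<close> means that the
  path stays in the cube up to time \<open>T\<close>, after which the walk of centres is frozen. Conditional full
  support, applied at rational times slightly after the exit times, shows that every displacement has positive
  conditional probability. Reweighting by the ratio of fixed symmetric weights to these conditional
  probabilities therefore turns the walk of centres into a martingale. As the weight of \<open>0\<close> is at
  least one half, the walk freezes geometrically fast, so no mass is lost in the infinite product of densities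
  and the terminal centre is integrable. Its conditional expectation at time \<open>t\<close> lies in the cube
  that contains the path at time \<open>t\<close>, hence is close to the path in ratio and stays in the open set.
\<close>

section \<open>Cubes and displacements\<close>

text \<open>Rounding is what makes the reweighting possible. A martingale built from the exit points
  themselves would require control over the conditional law of a position on the faces of a cube;
  with finitely many displacements it is enough that each has positive conditional probability. The
  price is that a new cube is not centred at the current position of the path, so the constants must
  keep that position strictly inside the new cube. The remaining slack also forces a definite
  movement before the next exit, which rules out infinitely many exits. At an exit some coordinate
  is exactly one radius away from the centre, and such a coordinate never rounds to 0. Hence
  displacement 0 remains free to encode that no exit occurs before \<open>T\<close>. Radii
  proportional to the distance from the complement serve two ends: the cubes and their neighbours
  stay inside the set, and, since this distance is at most each coordinate in the positive orthant,
  the error is small relative to every coordinate.\<close>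

definition ccube :: "real ^ 'n::finite \<Rightarrow> real \<Rightarrow> (real ^ 'n) set" where
  "ccube x r = {y. \<forall>i. \<bar>y $ i - x $ i\<bar> \<le> r}"

definition ocube :: "real ^ 'n::finite \<Rightarrow> real \<Rightarrow> (real ^ 'n) set" where
  "ocube x r = {y. \<forall>i. \<bar>y $ i - x $ i\<bar> < r}"

definition grid :: "(real ^ 'n::finite) set" where
  "grid = {d. \<forall>i. d $ i \<in> {-1, 0, 1}}"

definition round_vec :: "real ^ 'n::finite \<Rightarrow> real ^ 'n" where
  "round_vec y = (\<chi> i. real_of_int (round (y $ i)))"

lemma closed_ccube: "closed (ccube x r)"
proof -
  have "ccube x r = (\<Inter>i. {y. \<bar>y $ i - x $ i\<bar> \<le> r})" by (auto simp: ccube_def)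
  also have "closed \<dots>" by (intro closed_INT ballI closed_Collect_le continuous_intros)
  finally show ?thesis .
qed

lemma open_ocube: "open (ocube x r)"
proof -
  have "ocube x r = (\<Inter>i. {y. \<bar>y $ i - x $ i\<bar> < r})" by (auto simp: ocube_def)
  also have "open \<dots>" by (intro open_INT ballI open_Collect_less continuous_intros) auto
  finally show ?thesis .
qed

lemma ocube_subset_ccube: "ocube x r \<subseteq> ccube x r"
  by (auto simp: ocube_def ccube_def intro: less_imp_le)

lemma ccube_subset_ocube: "r < r' \<Longrightarrow> ccube x r \<subseteq> ocube x r'"
  by (auto simp: ocube_def ccube_def intro: le_less_trans)

lemma convex_ocube: "convex (ocube x r)"
proof -
  have "ocube x r = (\<Inter>i. {y. axis i 1 \<bullet> y < x $ i + r} \<inter> {y. axis i 1 \<bullet> y > x $ i - r})"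
    by (auto simp: ocube_def inner_axis' abs_less_iff algebra_simps)
  also have "convex \<dots>"
    by (intro convex_INT convex_Int convex_halfspace_lt convex_halfspace_gt)
  finally show ?thesis .
qed

lemma norm_le_card_mult:
  fixes v :: "real ^ 'n::finite"
  assumes "\<And>i. \<bar>v $ i\<bar> \<le> r"
  shows "norm v \<le> real CARD('n) * r"
proof -
  have "norm v \<le> (\<Sum>i\<in>UNIV. \<bar>v $ i\<bar>)" by (rule norm_le_l1_cart)
  also have "\<dots> \<le> (\<Sum>i\<in>(UNIV::'n set). r)" by (intro sum_mono assms)
  finally show ?thesis by simp
qed

lemma finite_grid: "finite (grid :: (real ^ 'n::finite) set)"
proof -
  have "grid \<subseteq> vec_lambda ` (Pi\<^sub>E (UNIV :: 'n set) (\<lambda>_. {-1, 0, 1 :: real}))"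
  proof
    fix d :: "real ^ 'n" assume "d \<in> grid"
    then have "vec_nth d \<in> Pi\<^sub>E UNIV (\<lambda>_. {-1, 0, 1})" by (auto simp: grid_def)
    then show "d \<in> vec_lambda ` (Pi\<^sub>E UNIV (\<lambda>_. {-1, 0, 1}))"
      by (intro image_eqI[of _ _ "vec_nth d"]) simp_all
  qed
  then show ?thesis by (rule finite_subset) (intro finite_imageI finite_PiE, auto)
qed

lemma zero_in_grid: "0 \<in> grid"
  by (simp add: grid_def)

lemma uminus_in_grid_iff: "- d \<in> grid \<longleftrightarrow> d \<in> grid"
proof -
  have "- a \<in> {-1, 0, 1} \<longleftrightarrow> a \<in> {-1, 0, 1 :: real}" for a by auto
  then show ?thesis unfolding grid_def by (simp only: mem_Collect_eq vector_uminus_component)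
qed

lemma abs_grid_le: "d \<in> grid \<Longrightarrow> \<bar>d $ i\<bar> \<le> 1"
  unfolding grid_def by (drule CollectD, drule spec[of _ i]) auto

lemma grid_abs_eq_one:
  assumes "d \<in> grid" "d \<noteq> 0"
  obtains i where "\<bar>d $ i\<bar> = 1"
proof -
  obtain i where "d $ i \<noteq> 0" using assms(2) by (auto simp: vec_eq_iff)
  moreover have "d $ i \<in> {-1, 0, 1}" using assms(1) by (simp add: grid_def)
  ultimately show ?thesis using that[of i] by auto
qed

lemma round_vec_in_grid:
  assumes "\<And>i. \<bar>y $ i\<bar> \<le> 1"
  shows "round_vec y \<in> grid"
proof -
  have "real_of_int (round (y $ i)) \<in> {-1, 0, 1}" for i
  proof -
    have "round (y $ i) \<le> round (1::real)" "round (-1::real) \<le> round (y $ i)"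
      using assms[of i] by (intro round_mono; simp add: abs_le_iff)+
    moreover have "round (1::real) = 1" "round (-1::real) = -1"
      by (auto intro: round_unique')
    ultimately have "round (y $ i) \<in> {-1, 0, 1}" by auto
    then show ?thesis by auto
  qed
  then show ?thesis by (simp add: grid_def round_vec_def)
qed

lemma round_vec_eqI:
  assumes "d \<in> grid" "\<And>i. \<bar>y $ i - d $ i\<bar> < 1 / 2"
  shows "round_vec y = d"
proof -
  have "real_of_int (round (y $ i)) = d $ i" for i
  proof -
    obtain m :: int where m: "d $ i = real_of_int m"
      using assms(1) unfolding grid_def
      by (metis (mono_tags, lifting) insert_iff mem_Collect_eq of_int_0 of_int_1 of_int_minus singletonD)
    then show ?thesis using assms(2)[of i] round_unique'[of "y $ i" m] by simp
  qed
  then show ?thesis by (simp add: round_vec_def vec_eq_iff)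
qed

lemma round_vec_nonzero:
  assumes "\<bar>y $ i\<bar> = 1"
  shows "round_vec y \<noteq> 0"
proof -
  have "\<bar>real_of_int (round (y $ i)) - y $ i\<bar> \<le> 1/2" by (rule of_int_round_abs_le)
  then have "real_of_int (round (y $ i)) \<noteq> 0" using assms by auto
  then show ?thesis by (auto simp: round_vec_def vec_eq_iff)
qed

lemma borel_measurable_vec_iff:
  fixes f :: "'a \<Rightarrow> real ^ 'n::finite"
  shows "f \<in> borel_measurable N \<longleftrightarrow> (\<forall>i. (\<lambda>\<omega>. f \<omega> $ i) \<in> borel_measurable N)"
  unfolding borel_measurable_euclidean_space[of f]
  by (auto simp: Basis_vec_def inner_axis)

lemma borel_measurable_component [measurable (raw)]:
  fixes f :: "'a \<Rightarrow> real ^ 'n::finite"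
  shows "f \<in> borel_measurable N \<Longrightarrow> (\<lambda>\<omega>. f \<omega> $ i) \<in> borel_measurable N"
  using borel_measurable_vec_iff by blast

lemma borel_measurable_round_vec [measurable (raw)]:
  fixes f :: "'a \<Rightarrow> real ^ 'n::finite"
  assumes [measurable]: "f \<in> borel_measurable N"
  shows "(\<lambda>\<omega>. round_vec (f \<omega>)) \<in> borel_measurable N"
  unfolding borel_measurable_vec_iff round_vec_def round_def by simp

section \<open>Conditional expectations bounded on an event\<close>

text \<open>Test the hypothesis on the part of \<open>C\<close> where the conditional expectation
  exceeds \<open>u\<close>: there a nonnegative function has nonpositive integral, so it vanishes
  almost everywhere. The localisation to \<open>C\<close> is needed because the terminal centre is
  bounded by different constants on different pieces of the probability space.\<close>

lemma (in sigma_finite_subalgebra) real_cond_exp_le_on: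
  assumes fin: "finite_measure M" and f: "integrable M f" and C: "C \<in> sets F"
    and le: "\<And>A. A \<in> sets F \<Longrightarrow> A \<subseteq> C \<Longrightarrow> (\<integral>\<omega>. indicator A \<omega> * f \<omega> \<partial>M) \<le> u * measure M A"
  shows "AE \<omega> in M. \<omega> \<in> C \<longrightarrow> real_cond_exp M F f \<omega> \<le> u"
proof -
  interpret finite_measure M by (rule fin)
  let ?V = "real_cond_exp M F f"
  define A where "A = C \<inter> {\<omega> \<in> space F. u < ?V \<omega>}"
  have A: "A \<in> sets F" unfolding A_def using C by measurable
  then have AM: "A \<in> sets M" using subalg by (auto simp: subalgebra_def)
  have iV: "integrable M (\<lambda>\<omega>. indicator A \<omega> * ?V \<omega>)"
    using integrable_real_mult_indicator[OF AM real_cond_exp_int(1)[OF f]] by (simp add: mult.commute)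
  have iu: "integrable M (\<lambda>\<omega>. indicator A \<omega> * u)"
    using AM by (intro integrable_mult_left integrable_real_indicator) (auto simp: less_top[symmetric])
  have "(\<integral>\<omega>. indicator A \<omega> * ?V \<omega> - indicator A \<omega> * u \<partial>M)
      = (\<integral>\<omega>. indicator A \<omega> * ?V \<omega> \<partial>M) - u * measure M A"
    using iV iu AM by (subst Bochner_Integration.integral_diff) auto
  also have "(\<integral>\<omega>. indicator A \<omega> * ?V \<omega> \<partial>M) = (\<integral>\<omega>. indicator A \<omega> * f \<omega> \<partial>M)"
    using real_cond_exp_intA[OF f A] by (simp add: set_lebesgue_integral_def)
  also have "\<dots> - u * measure M A \<le> 0" using le[OF A] by (auto simp: A_def)
  finally have "(\<integral>\<omega>. indicator A \<omega> * ?V \<omega> - indicator A \<omega> * u \<partial>M) \<le> 0" .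
  moreover have nn: "0 \<le> indicator A \<omega> * ?V \<omega> - indicator A \<omega> * u" for \<omega>
    by (auto simp: A_def indicator_def)
  ultimately have "(\<integral>\<omega>. indicator A \<omega> * ?V \<omega> - indicator A \<omega> * u \<partial>M) = 0"
    by (intro antisym Bochner_Integration.integral_nonneg)
  then have "AE \<omega> in M. indicator A \<omega> * ?V \<omega> - indicator A \<omega> * u = 0"
    using integral_nonneg_eq_0_iff_AE[OF Bochner_Integration.integrable_diff[OF iV iu]] nn by simp
  moreover have "AE \<omega> in M. \<omega> \<in> space M" by (rule AE_space)
  ultimately show ?thesis
  proof eventually_elim
    case (elim \<omega>)
    then have "\<omega> \<in> space F" using subalg by (simp add: subalgebra_def)
    then show ?case using elim by (auto simp: A_def indicator_def split: if_splits)
  qed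
qed

lemma (in sigma_finite_subalgebra) real_cond_exp_ge_on:
  assumes fin: "finite_measure M" and f: "integrable M f" and C: "C \<in> sets F"
    and ge: "\<And>A. A \<in> sets F \<Longrightarrow> A \<subseteq> C \<Longrightarrow> l * measure M A \<le> (\<integral>\<omega>. indicator A \<omega> * f \<omega> \<partial>M)"
  shows "AE \<omega> in M. \<omega> \<in> C \<longrightarrow> l \<le> real_cond_exp M F f \<omega>"
proof -
  have "AE \<omega> in M. \<omega> \<in> C \<longrightarrow> real_cond_exp M F (\<lambda>\<omega>. - 1 * f \<omega>) \<omega> \<le> - l"
    using f ge by (intro real_cond_exp_le_on[OF fin _ C]) auto
  moreover have "AE \<omega> in M. real_cond_exp M F (\<lambda>\<omega>. - 1 * f \<omega>) \<omega> = - 1 * real_cond_exp M F f \<omega>"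
    by (rule real_cond_exp_cmult[OF f])
  ultimately show ?thesis by eventually_elim auto
qed

section \<open>The walk of cube centres\<close>

text \<open>\<open>\<kappa>_le\<close> bounds the variation of the radius over a cube by an eighth
  of the half-side of the cube. \<open>X0_near\<close> is the case \<open>k = 0\<close> of
  \<open>state_invariant\<close>, with the radius written out; \<open>countable_X0\<close> starts
  the induction that all centres have countable range.\<close>

locale cfs_process = prob_space M
  for M :: "'a measure" +
  fixes F :: "real \<Rightarrow> 'a measure" and T :: real
    and Ob :: "(real ^ 'n::finite) set" and S :: "real \<Rightarrow> 'a \<Rightarrow> real ^ 'n"
    and \<kappa> :: real and X0 :: "'a \<Rightarrow> real ^ 'n"
  assumes T_pos: "T > 0"
    and subalg_F: "t \<in> {0..T} \<Longrightarrow> subalgebra M (F t)"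
    and F_mono: "0 \<le> s \<Longrightarrow> s \<le> t \<Longrightarrow> t \<le> T \<Longrightarrow> sets (F s) \<subseteq> sets (F t)"
    and S_process: "cont_adapted_process M F T Ob S"
    and S_cfs: "cond_full_support M F T Ob S"
    and open_Ob: "open Ob" and Ob_pos: "x \<in> Ob \<Longrightarrow> 0 < x $ i"
    and \<kappa>_pos: "\<kappa> > 0" and \<kappa>_le: "\<kappa> * (8 * real CARD('n)) \<le> 1"
    and X0_meas: "X0 \<in> borel_measurable (F 0)"
    and countable_X0: "countable (X0 ` space M)"
    and X0_in: "\<omega> \<in> space M \<Longrightarrow> X0 \<omega> \<in> Ob"
    and X0_near: "\<omega> \<in> space M \<Longrightarrow> S 0 \<omega> \<in> ccube (X0 \<omega>) (3/4 * (\<kappa> * infdist (X0 \<omega>) (- Ob)))"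
    and X0_integrable: "(\<integral>\<^sup>+\<omega>. ennreal (X0 \<omega> $ i) \<partial>M) < \<infinity>"
begin

text \<open>A nonempty complement is essential for the radius: \<open>infdist\<close> to the empty
  set is 0.\<close>

lemma Ob_ne_UNIV: "Ob \<noteq> UNIV"
  using Ob_pos[of 0 undefined] by auto

definition rad :: "real ^ 'n \<Rightarrow> real" where
  "rad x = \<kappa> * infdist x (- Ob)"

text \<open>Inserting \<open>T\<close> caps the exit time and keeps the infimum away from the empty
  set. The value \<open>T\<close> thus stands both for staying in the cube and for an exit exactly
  at \<open>T\<close>.\<close>

definition exit :: "real \<Rightarrow> real ^ 'n \<Rightarrow> 'a \<Rightarrow> real" where
  "exit a x \<omega> = Inf (insert T {s. a < s \<and> 0 \<le> s \<and> s \<le> T \<and> S s \<omega> \<notin> ccube x (rad x)})"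

definition step :: "real \<Rightarrow> real ^ 'n \<Rightarrow> 'a \<Rightarrow> real ^ 'n" where
  "step a x \<omega> = (if exit a x \<omega> < T then round_vec ((S (exit a x \<omega>) \<omega> - x) /\<^sub>R rad x) else 0)"

text \<open>Starting at \<open>-1\<close> makes the half-open intervals \<open>(\<tau> k, \<tau> (k + 1)]\<close> cover time \<open>0\<close> as well.\<close>

primrec state :: "nat \<Rightarrow> 'a \<Rightarrow> real \<times> (real ^ 'n)" where
  "state 0 \<omega> = (-1, X0 \<omega>)"
| "state (Suc k) \<omega> = (case state k \<omega> of (\<tau>, x) \<Rightarrow> (exit \<tau> x \<omega>, x + rad x *\<^sub>R step \<tau> x \<omega>))"

definition \<tau> :: "nat \<Rightarrow> 'a \<Rightarrow> real" where "\<tau> k \<omega> = fst (state k \<omega>)"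
definition X :: "nat \<Rightarrow> 'a \<Rightarrow> real ^ 'n" where "X k \<omega> = snd (state k \<omega>)"
definition lab :: "nat \<Rightarrow> 'a \<Rightarrow> real ^ 'n" where "lab k \<omega> = step (\<tau> k \<omega>) (X k \<omega>) \<omega>"

lemma \<tau>_0 [simp]: "\<tau> 0 \<omega> = -1" and X_0 [simp]: "X 0 \<omega> = X0 \<omega>"
  by (simp_all add: \<tau>_def X_def)

lemma \<tau>_Suc: "\<tau> (Suc k) \<omega> = exit (\<tau> k \<omega>) (X k \<omega>) \<omega>"
  and X_Suc: "X (Suc k) \<omega> = X k \<omega> + rad (X k \<omega>) *\<^sub>R lab k \<omega>"
  by (simp_all add: \<tau>_def X_def lab_def split: prod.splits)

lemma S_cont: "\<omega> \<in> space M \<Longrightarrow> continuous_on {0..T} (\<lambda>t. S t \<omega>)"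
  and S_adapted: "t \<in> {0..T} \<Longrightarrow> S t \<in> borel_measurable (F t)"
  and S_in: "t \<in> {0..T} \<Longrightarrow> \<omega> \<in> space M \<Longrightarrow> S t \<omega> \<in> Ob"
  using S_process by (auto simp: cont_adapted_process_def)

lemma rad_nonneg: "0 \<le> rad x"
  using \<kappa>_pos by (simp add: rad_def infdist_nonneg)

lemma rad_pos: "x \<in> Ob \<Longrightarrow> 0 < rad x"
  unfolding rad_def using \<kappa>_pos open_Ob Ob_ne_UNIV
  by (intro mult_pos_pos infdist_pos_not_in_closed) (auto simp: closed_def)

lemma rad_lipschitz: "\<bar>rad x - rad y\<bar> \<le> \<kappa> * dist x y"
proof -
  have "\<bar>rad x - rad y\<bar> = \<kappa> * \<bar>infdist x (-Ob) - infdist y (-Ob)\<bar>"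
    using \<kappa>_pos by (simp add: rad_def abs_mult flip: right_diff_distrib)
  then show ?thesis
    using \<kappa>_pos by (simp add: infdist_triangle_abs mult_left_mono)
qed

text \<open>The Euclidean distance is at most the dimension times the sup-norm distance; the factor
  8 CARD('n) in \<open>\<kappa>_le\<close> is chosen to absorb this.\<close>

lemma dist_le_of_ccube:
  fixes x y :: "real ^ 'n"
  assumes "y \<in> ccube x r"
  shows "\<kappa> * dist y x \<le> r / 8"
proof -
  have r: "0 \<le> r" using assms abs_ge_zero order_trans unfolding ccube_def by blast
  have "dist y x \<le> real CARD('n) * r"
    unfolding dist_norm by (rule norm_le_card_mult) (use assms in \<open>simp add: ccube_def\<close>)
  then have "\<kappa> * dist y x \<le> \<kappa> * (real CARD('n) * r)" using \<kappa>_pos by simp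
  also have "\<dots> = \<kappa> * (8 * real CARD('n)) * (r / 8)" by simp
  also have "\<dots> \<le> 1 * (r / 8)" using r by (intro mult_right_mono \<kappa>_le) auto
  finally show ?thesis by simp
qed

lemma rad_ccube:
  assumes "y \<in> ccube x r"
  shows "\<bar>rad y - rad x\<bar> \<le> r / 8"
  using rad_lipschitz[of y x] dist_le_of_ccube[OF assms] by linarith

text \<open>Over the doubled cube \<open>rad\<close> changes by at most a quarter of its value at
  the centre, so it stays positive, whereas it vanishes off \<open>Ob\<close>. The doubling leaves
  room for the half-size cubes around the neighbouring centres, which reach out to 3/2 of the
  radius.\<close>

lemma ccube_subset:
  assumes "x \<in> Ob"
  shows "ccube x (2 * rad x) \<subseteq> Ob"
proof
  fix y assume y: "y \<in> ccube x (2 * rad x)"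
  have "\<bar>rad y - rad x\<bar> \<le> 2 * rad x / 8" using rad_ccube[OF y] .
  then have "rad y > 0" using rad_pos[OF assms] by linarith
  then show "y \<in> Ob" using \<kappa>_pos by (cases "y \<in> Ob") (auto simp: rad_def)
qed

lemma ccube_mono: "r \<le> r' \<Longrightarrow> ccube x r \<subseteq> ccube x r'"
  by (auto simp: ccube_def intro: order_trans)

section \<open>Exit of a continuous path from a cube\<close>

lemma bdd_below_exit: "bdd_below (insert T {s. a < s \<and> 0 \<le> s \<and> s \<le> T \<and> S s \<omega> \<notin> ccube x (rad x)})"
  using T_pos by (intro bdd_belowI[of _ 0]) auto

lemma exit_le_T: "exit a x \<omega> \<le> T"
  unfolding exit_def by (intro cInf_lower bdd_below_exit) auto

lemma exit_less_iff:
  assumes "t \<le> T"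
  shows "exit a x \<omega> < t \<longleftrightarrow> (\<exists>s. a < s \<and> 0 \<le> s \<and> s < t \<and> S s \<omega> \<notin> ccube x (rad x))"
  unfolding exit_def using assms
  by (subst cInf_less_iff) (auto intro!: bdd_below_exit)

lemma before_exit:
  assumes "a < s" "0 \<le> s" "s < exit a x \<omega>"
  shows "S s \<omega> \<in> ccube x (rad x)"
  using exit_less_iff[of "exit a x \<omega>" a x \<omega>] exit_le_T[of a x \<omega>] assms by auto

lemma exit_nonneg: "0 \<le> exit a x \<omega>"
  using T_pos unfolding exit_def by (intro cInf_greatest) auto

lemma exit_ge: "a \<le> T \<Longrightarrow> a \<le> exit a x \<omega>"
  unfolding exit_def by (intro cInf_greatest) auto

lemma near_right:
  assumes "\<omega> \<in> space M" "0 \<le> u" "u < T" "open W" "S u \<omega> \<in> W"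
  obtains e where "e > 0" "u + e \<le> T" "\<And>s. u \<le> s \<Longrightarrow> s < u + e \<Longrightarrow> S s \<omega> \<in> W"
proof -
  have "((\<lambda>s. S s \<omega>) \<longlongrightarrow> S u \<omega>) (at u within {0..T})"
    using S_cont[OF assms(1)] assms(2,3) by (auto simp: continuous_on)
  then have "eventually (\<lambda>s. S s \<omega> \<in> W) (at u within {0..T})"
    using assms(4,5) by (rule topological_tendstoD)
  then obtain d where d: "d > 0" "\<And>s. s \<in> {0..T} \<Longrightarrow> s \<noteq> u \<Longrightarrow> dist s u < d \<Longrightarrow> S s \<omega> \<in> W"
    unfolding eventually_at by blast
  show ?thesis
  proof (rule that[of "min d (T - u)"])
    show "0 < min d (T - u)" "u + min d (T - u) \<le> T" using d(1) assms by auto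
    fix s assume "u \<le> s" "s < u + min d (T - u)"
    then show "S s \<omega> \<in> W"
      using d(2)[of s] assms by (cases "s = u") (auto simp: dist_real_def)
  qed
qed

text \<open>Starting in the open cube makes the inequality strict, since a continuous path stays
  there for a while. The starting time is \<open>max a 0\<close> because \<open>a\<close> may be the
  artificial time -1.\<close>

lemma exit_gt:
  assumes "\<omega> \<in> space M" "a < T" "S (max a 0) \<omega> \<in> ocube x (rad x)"
  shows "max a 0 < exit a x \<omega>"
proof -
  from assms(2) T_pos have "max a 0 < T" by auto
  then obtain e where e: "e > 0" "max a 0 + e \<le> T"
      "\<And>s. max a 0 \<le> s \<Longrightarrow> s < max a 0 + e \<Longrightarrow> S s \<omega> \<in> ocube x (rad x)"
    using near_right[OF assms(1) _ _ open_ocube assms(3)] by auto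
  have "\<not> exit a x \<omega> < max a 0 + e"
  proof
    assume "exit a x \<omega> < max a 0 + e"
    then obtain s where "a < s" "0 \<le> s" "s < max a 0 + e" "S s \<omega> \<notin> ccube x (rad x)"
      unfolding exit_less_iff[OF e(2)] by blast
    then show False using e(3)[of s] ocube_subset_ccube by auto
  qed
  then show ?thesis using e(1) by linarith
qed

lemma until_exit:
  assumes "\<omega> \<in> space M" "a < T" "S (max a 0) \<omega> \<in> ocube x (rad x)"
    and "a < s" "0 \<le> s" "s \<le> exit a x \<omega>"
  shows "S s \<omega> \<in> ccube x (rad x)"
proof (cases "s < exit a x \<omega>")
  case True
  then show ?thesis using before_exit assms by blast
next
  case False
  then have s: "s = exit a x \<omega>" using assms by simp
  let ?u = "max a 0"
  have u: "?u < s" using exit_gt[OF assms(1-3)] s by simp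
  have "s \<in> closure {?u<..<s}" using u by simp
  moreover have "continuous_on (closure {?u<..<s}) (\<lambda>t. S t \<omega>)"
    using u exit_le_T[of a x \<omega>] s by (intro continuous_on_subset[OF S_cont[OF assms(1)]]) auto
  moreover have "(\<lambda>t. S t \<omega>) ` {?u<..<s} \<subseteq> ccube x (rad x)"
    using before_exit s by auto
  ultimately show ?thesis
    using image_closure_subset[OF _ closed_ccube] by blast
qed

text \<open>By continuity the exit point still lies in the closed cube. If it were in the open cube,
  the path would stay inside a little longer, contradicting the infimum; so it lies on a
  face.\<close>

lemma at_exit:
  assumes "\<omega> \<in> space M" "a < T" "S (max a 0) \<omega> \<in> ocube x (rad x)" "exit a x \<omega> < T"
  obtains i where "\<bar>S (exit a x \<omega>) \<omega> $ i - x $ i\<bar> = rad x"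
proof -
  let ?s = "exit a x \<omega>"
  have c: "S ?s \<omega> \<in> ccube x (rad x)"
    using until_exit[OF assms(1-3)] exit_gt[OF assms(1-3)] by simp
  have "S ?s \<omega> \<notin> ocube x (rad x)"
  proof
    assume "S ?s \<omega> \<in> ocube x (rad x)"
    then obtain e where e: "e > 0" "?s + e \<le> T"
        "\<And>s. ?s \<le> s \<Longrightarrow> s < ?s + e \<Longrightarrow> S s \<omega> \<in> ocube x (rad x)"
      using near_right[OF assms(1) exit_nonneg assms(4) open_ocube] by blast
    have "\<exists>s. a < s \<and> 0 \<le> s \<and> s < ?s + e \<and> S s \<omega> \<notin> ccube x (rad x)"
      using exit_less_iff[OF e(2), of a x \<omega>] e(1) by simp
    then show False
      using e(3) before_exit ocube_subset_ccube by (meson not_le subsetD)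
  qed
  then show ?thesis using c that
    by (auto simp: ccube_def ocube_def) (meson antisym not_le)
qed

text \<open>The factor 3/4 reproduces itself: rounding moves the exit point by at most half of the
  old radius, the new radius is at least 7/8 of the old one by \<open>rad_ccube\<close>, and 1/2
  \<le> 3/4 * 7/8. Being below 1, the factor puts the path into the open cube, so the next exit is
  strictly later.\<close>

lemma state_invariant:
  assumes "\<omega> \<in> space M"
  shows "X k \<omega> \<in> Ob \<and> \<tau> k \<omega> \<le> T \<and>
    (\<tau> k \<omega> < T \<longrightarrow> S (max (\<tau> k \<omega>) 0) \<omega> \<in> ccube (X k \<omega>) (3/4 * rad (X k \<omega>)))"
proof (induction k)
  case 0
  then show ?case using X0_in[OF assms] X0_near[OF assms] T_pos by (simp add: rad_def)
next
  case (Suc k)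
  let ?x = "X k \<omega>" and ?t = "\<tau> k \<omega>" and ?t' = "\<tau> (Suc k) \<omega>"
  have x: "?x \<in> Ob" "rad ?x > 0" using Suc rad_pos by auto
  show ?case
  proof (cases "?t' < T")
    case False
    then have "lab k \<omega> = 0" by (simp add: lab_def step_def \<tau>_Suc)
    then show ?thesis using False x exit_le_T by (simp add: X_Suc \<tau>_Suc)
  next
    case True
    have "?t < T" using True exit_ge[of ?t ?x \<omega>] Suc by (auto simp: \<tau>_Suc)
    moreover from this have near: "S (max ?t 0) \<omega> \<in> ocube ?x (rad ?x)"
      using Suc x(2) ccube_subset_ocube[of "3/4 * rad ?x" "rad ?x" ?x] by auto
    ultimately have c: "S ?t' \<omega> \<in> ccube ?x (rad ?x)"
      using until_exit[OF assms, of ?t ?x ?t'] exit_gt[OF assms, of ?t ?x] by (auto simp: \<tau>_Suc)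
    define y where "y = (S ?t' \<omega> - ?x) /\<^sub>R rad ?x"
    have Sy: "S ?t' \<omega> = ?x + rad ?x *\<^sub>R y" using x(2) by (simp add: y_def)
    have "\<bar>y $ i\<bar> \<le> 1" for i
      using c x(2) by (auto simp: y_def ccube_def abs_mult divide_simps)
    then have g: "round_vec y \<in> grid" by (rule round_vec_in_grid)
    have l: "lab k \<omega> = round_vec y" using True by (simp add: lab_def step_def \<tau>_Suc y_def)
    have X': "X (Suc k) \<omega> = ?x + rad ?x *\<^sub>R round_vec y" by (simp add: X_Suc l)
    have cX: "X (Suc k) \<omega> \<in> ccube ?x (rad ?x)"
      using abs_grid_le[OF g] x(2) by (auto simp: X' ccube_def abs_mult mult_le_cancel_left1)
    then have in': "X (Suc k) \<omega> \<in> Ob"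
      using ccube_subset[OF x(1)] ccube_mono[of "rad ?x" "2 * rad ?x" ?x] x(2) by auto
    have r': "rad (X (Suc k) \<omega>) \<ge> 7/8 * rad ?x" using rad_ccube[OF cX] by linarith
    have "\<bar>S ?t' \<omega> $ i - X (Suc k) \<omega> $ i\<bar> \<le> 3/4 * rad (X (Suc k) \<omega>)" for i
    proof -
      have "S ?t' \<omega> $ i - X (Suc k) \<omega> $ i = rad ?x * (y $ i - round_vec y $ i)"
        unfolding Sy X' by (simp add: algebra_simps)
      moreover have "\<bar>y $ i - round_vec y $ i\<bar> \<le> 1/2"
        using of_int_round_abs_le[of "y $ i"] by (simp add: round_vec_def abs_minus_commute)
      ultimately have "\<bar>S ?t' \<omega> $ i - X (Suc k) \<omega> $ i\<bar> \<le> rad ?x * (1/2)"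
        using x(2) by (simp add: abs_mult mult_le_cancel_left_pos)
      then show ?thesis using r' x(2) by linarith
    qed
    then have "S ?t' \<omega> \<in> ccube (X (Suc k) \<omega>) (3/4 * rad (X (Suc k) \<omega>))" by (simp add: ccube_def)
    moreover have "max ?t' 0 = ?t'" using exit_nonneg[of ?t ?x \<omega>] by (simp add: \<tau>_Suc)
    ultimately show ?thesis using in' True by simp
  qed
qed

lemma X_in: "\<omega> \<in> space M \<Longrightarrow> X k \<omega> \<in> Ob"
  and \<tau>_le_T: "\<omega> \<in> space M \<Longrightarrow> \<tau> k \<omega> \<le> T"
  using state_invariant by auto

lemma rad_X_pos: "\<omega> \<in> space M \<Longrightarrow> 0 < rad (X k \<omega>)"
  by (intro rad_pos X_in)

lemma S_\<tau>_ccube: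
  assumes "\<omega> \<in> space M" "\<tau> k \<omega> < T"
  shows "S (max (\<tau> k \<omega>) 0) \<omega> \<in> ccube (X k \<omega>) (3/4 * rad (X k \<omega>))"
  using state_invariant assms by blast

lemma S_\<tau>_ocube:
  assumes "\<omega> \<in> space M" "\<tau> k \<omega> < T"
  shows "S (max (\<tau> k \<omega>) 0) \<omega> \<in> ocube (X k \<omega>) (rad (X k \<omega>))"
  using S_\<tau>_ccube[OF assms] rad_X_pos[OF assms(1), of k]
    ccube_subset_ocube[of "3/4 * rad (X k \<omega>)" "rad (X k \<omega>)" "X k \<omega>"] by auto

lemma \<tau>_Suc_ge: "\<omega> \<in> space M \<Longrightarrow> \<tau> k \<omega> \<le> \<tau> (Suc k) \<omega>"
  unfolding \<tau>_Suc by (intro exit_ge \<tau>_le_T)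

lemma \<tau>_mono: "\<omega> \<in> space M \<Longrightarrow> j \<le> k \<Longrightarrow> \<tau> j \<omega> \<le> \<tau> k \<omega>"
  by (rule lift_Suc_mono_le) (auto intro: \<tau>_Suc_ge)

lemma \<tau>_Suc_gt: "\<omega> \<in> space M \<Longrightarrow> \<tau> k \<omega> < T \<Longrightarrow> max (\<tau> k \<omega>) 0 < \<tau> (Suc k) \<omega>"
  unfolding \<tau>_Suc by (intro exit_gt S_\<tau>_ocube)

lemma S_between_ccube:
  assumes "\<omega> \<in> space M" "\<tau> k \<omega> < s" "0 \<le> s" "s \<le> \<tau> (Suc k) \<omega>"
  shows "S s \<omega> \<in> ccube (X k \<omega>) (rad (X k \<omega>))"
proof -
  have "\<tau> k \<omega> < T" using assms(2,4) exit_le_T unfolding \<tau>_Suc by (meson le_less_trans not_less order_trans)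
  then show ?thesis using until_exit S_\<tau>_ocube assms unfolding \<tau>_Suc by blast
qed

lemma S_\<tau>_Suc_boundary:
  assumes "\<omega> \<in> space M" "\<tau> (Suc k) \<omega> < T"
  obtains i where "\<bar>S (\<tau> (Suc k) \<omega>) \<omega> $ i - X k \<omega> $ i\<bar> = rad (X k \<omega>)"
proof -
  have "\<tau> k \<omega> < T" using \<tau>_Suc_ge assms by (meson le_less_trans)
  then show ?thesis using at_exit S_\<tau>_ocube assms that unfolding \<tau>_Suc by blast
qed

lemma lab_eq:
  "lab k \<omega> = (if \<tau> (Suc k) \<omega> < T
     then round_vec ((S (\<tau> (Suc k) \<omega>) \<omega> - X k \<omega>) /\<^sub>R rad (X k \<omega>)) else 0)"
  by (simp add: lab_def step_def \<tau>_Suc)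

lemma lab_in_grid:
  assumes "\<omega> \<in> space M"
  shows "lab k \<omega> \<in> grid"
proof (cases "\<tau> (Suc k) \<omega> < T")
  case True
  then have "\<tau> k \<omega> < T" using \<tau>_Suc_ge assms by (meson le_less_trans)
  then have "S (\<tau> (Suc k) \<omega>) \<omega> \<in> ccube (X k \<omega>) (rad (X k \<omega>))"
    using S_between_ccube[OF assms, of k "\<tau> (Suc k) \<omega>"] \<tau>_Suc_gt[OF assms, of k] by auto
  then have "round_vec ((S (\<tau> (Suc k) \<omega>) \<omega> - X k \<omega>) /\<^sub>R rad (X k \<omega>)) \<in> grid"
    using rad_X_pos[OF assms, of k] by (intro round_vec_in_grid) (auto simp: ccube_def abs_mult divide_simps)
  then show ?thesis using True by (simp add: lab_eq)
qed (simp add: lab_eq zero_in_grid)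

text \<open>An exit before \<open>T\<close> takes place on a face, where a rescaled coordinate has
  modulus 1 and survives rounding. So a zero displacement cannot come from a genuine exit.\<close>

lemma lab_eq_0_iff:
  assumes "\<omega> \<in> space M"
  shows "lab k \<omega> = 0 \<longleftrightarrow> \<tau> (Suc k) \<omega> = T"
proof (cases "\<tau> (Suc k) \<omega> < T")
  case True
  obtain i where "\<bar>S (\<tau> (Suc k) \<omega>) \<omega> $ i - X k \<omega> $ i\<bar> = rad (X k \<omega>)"
    using S_\<tau>_Suc_boundary[OF assms True] .
  then have "\<bar>((S (\<tau> (Suc k) \<omega>) \<omega> - X k \<omega>) /\<^sub>R rad (X k \<omega>)) $ i\<bar> = 1"
    using rad_X_pos[OF assms, of k] by (simp add: abs_mult)
  from round_vec_nonzero[OF this] show ?thesis using True by (auto simp: lab_eq)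
qed (use \<tau>_le_T[OF assms, of "Suc k"] in \<open>auto simp: lab_eq\<close>)

lemma X_Suc_ccube:
  assumes "\<omega> \<in> space M"
  shows "X (Suc k) \<omega> \<in> ccube (X k \<omega>) (rad (X k \<omega>))"
  using abs_grid_le[OF lab_in_grid[OF assms]] rad_X_pos[OF assms, of k]
  by (auto simp: X_Suc ccube_def abs_mult mult_le_cancel_left1)

lemma \<tau>_X_stationary:
  assumes "\<omega> \<in> space M" "\<tau> k \<omega> = T" "k \<le> j"
  shows "\<tau> j \<omega> = T" "X j \<omega> = X k \<omega>"
proof -
  have t: "\<tau> j \<omega> = T" if "k \<le> j" for j
    using \<tau>_mono[OF assms(1) that] \<tau>_le_T[OF assms(1), of j] assms(2) by simp
  then show "\<tau> j \<omega> = T" using assms(3) .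
  from assms(3) show "X j \<omega> = X k \<omega>"
  proof (induction rule: dec_induct)
    case (step m)
    have "lab m \<omega> = 0" using t[of "Suc m"] step(1) lab_eq_0_iff[OF assms(1)] by simp
    then show ?case using step by (simp add: X_Suc)
  qed simp
qed

text \<open>If the exit times accumulated, the path would converge to a point of the open set, so the radii
  would stay bounded below, whereas consecutive exits are at least a quarter radius apart.\<close>

lemma \<tau>_eventually_T:
  assumes "\<omega> \<in> space M"
  obtains k where "\<tau> k \<omega> = T"
proof (rule ccontr)
  assume "\<not> thesis"
  then have less: "\<tau> k \<omega> < T" for k using that \<tau>_le_T[OF assms, of k] by (meson le_less)
  \<comment> \<open>The shift discards the starting value -1, so that all times lie in
    \<open>{0..T}\<close>.\<close>
  define u where "u k = \<tau> (Suc k) \<omega>" for k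
  have u: "0 \<le> u k" "u k < T" for k
    using less \<tau>_Suc_gt[OF assms less, of k] by (auto simp: u_def)
  have "incseq u" by (intro incseq_SucI) (simp add: u_def \<tau>_Suc_ge assms)
  moreover have "Bseq u" using u by (intro BseqI'[of _ T]) (auto simp: less_imp_le)
  ultimately obtain l where l: "u \<longlonglongrightarrow> l" by (meson Bseq_monoseq_convergent convergentD incseq_imp_monoseq)
  have lin: "l \<in> {0..T}" using l u
    by (intro closed_sequentially[OF closed_atLeastAtMost _ l]) (auto simp: less_imp_le)
  have "((\<lambda>s. S s \<omega>) \<circ> u) \<longlonglongrightarrow> S l \<omega>"
    using S_cont[OF assms] lin l u unfolding continuous_on_sequentially by (auto simp: less_imp_le)
  then have Sl: "(\<lambda>k. S (u k) \<omega>) \<longlonglongrightarrow> S l \<omega>" by (simp add: o_def)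
  have "0 < rad (S l \<omega>)" using rad_pos S_in[OF lin assms] by blast
  define e where "e = rad (S l \<omega>)"
  have e: "e > 0" using \<open>0 < rad (S l \<omega>)\<close> e_def by simp
  have "\<kappa> \<le> 1 / 8"
  proof -
    have "\<kappa> * (8 * 1) \<le> \<kappa> * (8 * real CARD('n))" using \<kappa>_pos by (intro mult_left_mono) auto
    then show ?thesis using \<kappa>_le by linarith
  qed
  have "eventually (\<lambda>k. dist (S (u k) \<omega>) (S l \<omega>) < e / 16) sequentially"
    using Sl e by (intro tendstoD) auto
  then obtain K where K: "\<And>k. k \<ge> K \<Longrightarrow> dist (S (u k) \<omega>) (S l \<omega>) < e / 16"
    unfolding eventually_sequentially by blast
  let ?x = "X (Suc K) \<omega>"
  have near: "S (u K) \<omega> \<in> ccube ?x (3/4 * rad ?x)"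
    using S_\<tau>_ccube[OF assms less, of "Suc K"] u(1)[of K] by (simp add: u_def)
  obtain i where i: "\<bar>S (u (Suc K)) \<omega> $ i - ?x $ i\<bar> = rad ?x"
    using S_\<tau>_Suc_boundary[OF assms less] by (auto simp: u_def)
  have "\<bar>S (u K) \<omega> $ i - ?x $ i\<bar> \<le> 3/4 * rad ?x" using near by (simp add: ccube_def)
  moreover have "\<bar>S (u (Suc K)) \<omega> $ i - S (u K) \<omega> $ i\<bar> \<le> dist (S (u (Suc K)) \<omega>) (S (u K) \<omega>)"
    unfolding dist_norm using component_le_norm_cart[of "S (u (Suc K)) \<omega> - S (u K) \<omega>" i] by simp
  moreover have "dist (S (u (Suc K)) \<omega>) (S (u K) \<omega>) < e / 8"
    using K[of K] K[of "Suc K"] dist_triangle2[of "S (u (Suc K)) \<omega>" "S (u K) \<omega>" "S l \<omega>"] by simp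
  \<comment> \<open>From within 3/4 of the radius to a face the path moves at least a quarter
    radius, yet it moves less than e / 8. A radius below e / 2 is then incompatible with the
    Lipschitz bounds: \<open>rad\<close> at \<open>S (u K) \<omega>\<close> is at least 15/16 of
    \<open>e\<close> and at most 35/32 of \<open>rad ?x\<close>.\<close>
  ultimately have "rad ?x < e / 2" using i by linarith
  moreover have "\<bar>rad (S (u K) \<omega>) - rad ?x\<bar> \<le> 3/4 * rad ?x / 8" using rad_ccube[OF near] .
  moreover have "\<bar>rad (S (u K) \<omega>) - e\<bar> \<le> e / 16"
  proof -
    have "\<bar>rad (S (u K) \<omega>) - e\<bar> \<le> \<kappa> * dist (S (u K) \<omega>) (S l \<omega>)" unfolding e_def by (rule rad_lipschitz)
    also have "\<dots> \<le> 1 * dist (S (u K) \<omega>) (S l \<omega>)" using \<open>\<kappa> \<le> 1/8\<close> by (intro mult_right_mono) auto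
    finally show ?thesis using K[of K] by linarith
  qed
  ultimately show False using e by (simp add: abs_le_iff)
qed

section \<open>Information at the exit times\<close>

lemma borel_measurable_rad [measurable]: "rad \<in> borel_measurable borel"
  unfolding rad_def[abs_def] by (intro borel_measurable_continuous_onI continuous_intros)

lemma space_F: "t \<in> {0..T} \<Longrightarrow> space (F t) = space M"
  and sets_F_M: "t \<in> {0..T} \<Longrightarrow> A \<in> sets (F t) \<Longrightarrow> A \<in> sets M"
  using subalg_F by (auto simp: subalgebra_def)

lemma measurable_F_mono:
  assumes "0 \<le> s" "s \<le> t" "t \<le> T" "f \<in> measurable (F s) N"
  shows "f \<in> measurable (F t) N"
  using assms F_mono[OF assms(1-3)] space_F[of s] space_F[of t] by (auto simp: measurable_def)

lemma S_meas_F: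
  assumes "0 \<le> s" "s \<le> t" "t \<le> T"
  shows "S s \<in> borel_measurable (F t)"
  using measurable_F_mono[OF assms S_adapted] assms by auto

lemma S_meas_M: "t \<in> {0..T} \<Longrightarrow> S t \<in> borel_measurable M"
  using S_adapted subalg_F measurable_from_subalg by blast

definition before :: "nat \<Rightarrow> real \<Rightarrow> 'a set" where
  "before k t = {\<omega> \<in> space M. \<tau> k \<omega> < t}"

text \<open>The information up to \<open>\<tau> k\<close>, in the convention \<open>{\<tau> < t}\<close> instead of \<open>{\<tau> \<le> t}\<close>: this makes
  exit times from closed sets easy to handle and needs no right continuity of the filtration.\<close>

definition H_sets :: "nat \<Rightarrow> 'a set set" where
  "H_sets k = {A \<in> sets M. \<forall>t\<in>{0..T}. A \<inter> before k t \<in> sets (F t)}"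

text \<open>The generated sigma-algebra is taken because closure of \<open>H_sets k\<close> under
  complements requires \<open>before k t\<close> to be in \<open>F t\<close>, which is established
  only by the induction in \<open>before_X_measurable\<close>. Until then it appears as a hypothesis
  of the lemmas.\<close>

definition H :: "nat \<Rightarrow> 'a measure" where
  "H k = sigma (space M) (H_sets k)"

lemma space_H: "space (H k) = space M"
  unfolding H_def by (rule space_measure_of) (auto simp: H_sets_def dest: sets.sets_into_space)

lemma sets_H_aux:
  assumes "\<And>t. t \<in> {0..T} \<Longrightarrow> before k t \<in> sets (F t)"
  shows "sets (H k) = H_sets k"
proof -
  have "sigma_algebra (space M) (H_sets k)"
    unfolding sigma_algebra_iff2
  proof (intro conjI ballI allI impI)
    show "H_sets k \<subseteq> Pow (space M)" by (auto simp: H_sets_def dest: sets.sets_into_space)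
    show "{} \<in> H_sets k" by (auto simp: H_sets_def)
  next
    fix A assume A: "A \<in> H_sets k"
    have "(space M - A) \<inter> before k t = before k t - A \<inter> before k t" for t by (auto simp: before_def)
    then show "space M - A \<in> H_sets k" using A assms by (auto simp: H_sets_def)
  next
    fix A :: "nat \<Rightarrow> 'a set" assume A: "range A \<subseteq> H_sets k"
    have "(\<Union>i. A i) \<inter> before k t \<in> sets (F t)" if "t \<in> {0..T}" for t
    proof -
      have "(\<Union>i. A i \<inter> before k t) \<in> sets (F t)"
        using A that by (intro sets.countable_UN) (auto simp: H_sets_def)
      then show ?thesis by (simp only: UN_extend_simps)
    qed
    moreover have "(\<Union>i. A i) \<in> sets M" using A by (intro sets.countable_UN) (auto simp: H_sets_def)
    ultimately show "(\<Union>i. A i) \<in> H_sets k" by (simp only: H_sets_def mem_Collect_eq) blast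
  qed
  then show ?thesis unfolding H_def by (rule sigma_algebra.sets_measure_of_eq)
qed

text \<open>Whatever is known at the exit time is known at the fixed time \<open>t\<close> on the
  event that the exit came before \<open>t\<close>; off this event a constant is
  substituted.\<close>

lemma H_restrict:
  assumes "\<And>t. t \<in> {0..T} \<Longrightarrow> before k t \<in> sets (F t)"
    and f: "f \<in> borel_measurable (H k)" and t: "t \<in> {0..T}"
  shows "(\<lambda>\<omega>. if \<tau> k \<omega> < t then f \<omega> else c) \<in> borel_measurable (F t)"
proof (rule measurableI)
  fix B assume B: "B \<in> sets (borel :: 'b measure)"
  have "f -` B \<inter> space M \<in> H_sets k"
    using measurable_sets[OF f B] sets_H_aux[OF assms(1)] space_H by simp
  then have 1: "f -` B \<inter> space M \<inter> before k t \<in> sets (F t)" using t by (simp add: H_sets_def)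
  have 2: "space (F t) - before k t \<in> sets (F t)" using assms(1)[OF t] by auto
  have "(\<lambda>\<omega>. if \<tau> k \<omega> < t then f \<omega> else c) -` B \<inter> space (F t) =
    (f -` B \<inter> space M \<inter> before k t) \<union> (if c \<in> B then space (F t) - before k t else {})"
    using space_F[OF t] by (auto simp: before_def split: if_splits)
  then show "(\<lambda>\<omega>. if \<tau> k \<omega> < t then f \<omega> else c) -` B \<inter> space (F t) \<in> sets (F t)"
    using 1 2 by auto
qed simp

lemma H_restrictI:
  assumes "\<And>t. t \<in> {0..T} \<Longrightarrow> before k t \<in> sets (F t)"
    and "f \<in> borel_measurable M"
    and "\<And>t. t \<in> {0..T} \<Longrightarrow> (\<lambda>\<omega>. if \<tau> k \<omega> < t then f \<omega> else c) \<in> borel_measurable (F t)"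
  shows "f \<in> borel_measurable (H k)"
proof (rule measurableI)
  fix B assume B: "B \<in> sets (borel :: 'b measure)"
  have "f -` B \<inter> space M \<inter> before k t \<in> sets (F t)" if t: "t \<in> {0..T}" for t
  proof -
    have "f -` B \<inter> space M \<inter> before k t =
      ((\<lambda>\<omega>. if \<tau> k \<omega> < t then f \<omega> else c) -` B \<inter> space (F t)) \<inter> before k t"
      using space_F[OF t] by (auto simp: before_def)
    then show ?thesis using measurable_sets[OF assms(3)[OF t] B] assms(1)[OF t] by auto
  qed
  moreover have "f -` B \<inter> space M \<in> sets M" using measurable_sets[OF assms(2) B] .
  ultimately show "f -` B \<inter> space (H k) \<in> sets (H k)"
    using sets_H_aux[OF assms(1)] by (simp add: space_H H_sets_def)
qed simp

text \<open>Off the event, the exit time is replaced by \<open>t\<close>, which gives a time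
  \<open>v\<close> that is measurable with respect to \<open>F t\<close>. Approximating
  \<open>v\<close> from the right by times with countably many values makes the sampled path
  measurable; capping these times at \<open>t\<close> prevents a look into the future.\<close>

lemma S_\<tau>_restrict:
  assumes "\<And>t. t \<in> {0..T} \<Longrightarrow> before k t \<in> sets (F t)" and t: "t \<in> {0..T}"
  shows "(\<lambda>\<omega>. if \<tau> k \<omega> < t then S (max (\<tau> k \<omega>) 0) \<omega> else 0) \<in> borel_measurable (F t)"
proof -
  define v where "v \<omega> = (if \<tau> k \<omega> < t then max (\<tau> k \<omega>) 0 else t)" for \<omega>
  have b: "before k s \<in> sets (F t)" if "0 \<le> s" "s \<le> t" for s
    using assms(1)[of s] F_mono[of s t] that t by auto
  have v_meas [measurable]: "v \<in> borel_measurable (F t)"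
    unfolding borel_measurable_iff_less
  proof
    fix a :: real
    consider "a \<le> 0" | "0 < a" "a \<le> t" | "t < a" by linarith
    then show "{\<omega> \<in> space (F t). v \<omega> < a} \<in> sets (F t)"
    proof cases
      case 1
      then have "{\<omega> \<in> space (F t). v \<omega> < a} = {}" using t by (auto simp: v_def)
      then show ?thesis by (simp only: sets.empty_sets)
    next
      case 2
      then have "{\<omega> \<in> space (F t). v \<omega> < a} = before k a"
        using space_F[OF t] by (auto simp: v_def before_def split: if_splits)
      then show ?thesis using b 2 by simp
    next
      case 3
      then have "{\<omega> \<in> space (F t). v \<omega> < a} = space (F t)" using t by (auto simp: v_def)
      then show ?thesis by (simp only: sets.top)
    qed
  qed
  define w where "w m i = max 0 (min t ((real_of_int i + 1) / real (Suc m)))" for m and i :: int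
  define q where "q m \<omega> = w m \<lfloor>real (Suc m) * v \<omega>\<rfloor>" for m \<omega>
  have w: "0 \<le> w m i" "w m i \<le> t" for m i using t by (auto simp: w_def)
  have [measurable]: "S (w m i) \<in> borel_measurable (F t)" for m i
    using w[of m i] t by (intro S_meas_F) auto
  have [measurable]: "(\<lambda>\<omega>. S (q m \<omega>) \<omega>) \<in> borel_measurable (F t)" for m
    unfolding q_def
    by (rule measurable_compose_countable[where f="\<lambda>i \<omega>. S (w m i) \<omega>"]) measurable
  have [measurable]: "before k t \<in> sets (F t)" using assms by simp
  have lim: "(\<lambda>m. S (q m \<omega>) \<omega>) \<longlonglongrightarrow> S (v \<omega>) \<omega>" if \<omega>: "\<omega> \<in> space M" for \<omega>
  proof -
    have v: "0 \<le> v \<omega>" "v \<omega> \<le> t" using t by (auto simp: v_def)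
    have q: "v \<omega> \<le> q m \<omega> \<and> q m \<omega> \<le> v \<omega> + 1 / real (Suc m)" for m
    proof -
      let ?i = "\<lfloor>real (Suc m) * v \<omega>\<rfloor>"
      have "real (Suc m) * v \<omega> \<le> real_of_int ?i + 1" "real_of_int ?i \<le> real (Suc m) * v \<omega>"
        by linarith+
      then have "v \<omega> \<le> (real_of_int ?i + 1) / real (Suc m)"
        "(real_of_int ?i + 1) / real (Suc m) \<le> v \<omega> + 1 / real (Suc m)"
        by (simp_all add: field_simps del: of_nat_Suc)
      moreover have "0 \<le> v \<omega> + 1 / real (Suc m)" using v by simp
      ultimately show ?thesis using v unfolding q_def w_def by (auto simp: min_def max_def)
    qed
    have "(\<lambda>m. v \<omega> + 1 / real (Suc m)) \<longlonglongrightarrow> v \<omega> + 0"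
      by (rule tendsto_add[OF tendsto_const LIMSEQ_Suc[OF lim_1_over_n]])
    then have "(\<lambda>m. v \<omega> + 1 / real (Suc m)) \<longlonglongrightarrow> v \<omega>" by (simp only: add_0_right)
    from tendsto_sandwich[OF always_eventually always_eventually tendsto_const this, of "\<lambda>m. q m \<omega>"]
    have "(\<lambda>m. q m \<omega>) \<longlonglongrightarrow> v \<omega>" using q by blast
    moreover have "q m \<omega> \<in> {0..T}" for m
      using w[of m "\<lfloor>real (Suc m) * v \<omega>\<rfloor>"] t unfolding q_def by simp
    ultimately have "((\<lambda>s. S s \<omega>) \<circ> (\<lambda>m. q m \<omega>)) \<longlonglongrightarrow> S (v \<omega>) \<omega>"
      using S_cont[OF \<omega>] v t unfolding continuous_on_sequentially by auto
    then show ?thesis by (simp add: o_def)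
  qed
  have "(\<lambda>\<omega>. S (v \<omega>) \<omega>) \<in> borel_measurable (F t)"
    by (rule borel_measurable_LIMSEQ_metric[where f="\<lambda>m \<omega>. S (q m \<omega>) \<omega>"])
       (use lim space_F[OF t] in auto)
  then have "(\<lambda>\<omega>. if \<omega> \<in> before k t then S (v \<omega>) \<omega> else 0) \<in> borel_measurable (F t)"
    by measurable
  then show ?thesis
    by (rule measurable_cong[THEN iffD1, rotated]) (auto simp: before_def v_def space_F[OF t])
qed

lemma H_pred:
  assumes "\<And>t. t \<in> {0..T} \<Longrightarrow> before k t \<in> sets (F t)"
    and X: "X k \<in> borel_measurable (H k)" and q: "q \<in> {0..T}"
  shows "{\<omega> \<in> before k q. S q \<omega> \<notin> ccube (X k \<omega>) (rad (X k \<omega>))} \<in> sets (F q)"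
proof -
  define f where "f \<omega> = (if \<tau> k \<omega> < q then X k \<omega> else 0)" for \<omega>
  have [measurable]: "f \<in> borel_measurable (F q)"
    unfolding f_def[abs_def] by (rule H_restrict[OF assms(1) X q])
  have [measurable]: "S q \<in> borel_measurable (F q)" using S_adapted q by auto
  have [measurable]: "before k q \<in> sets (F q)" using assms(1) q by auto
  have "{\<omega> \<in> before k q. S q \<omega> \<notin> ccube (X k \<omega>) (rad (X k \<omega>))} =
    before k q \<inter> {\<omega> \<in> space (F q). \<not> (\<forall>i. \<bar>S q \<omega> $ i - f \<omega> $ i\<bar> \<le> rad (f \<omega>))}"
    using space_F[OF q] by (auto simp: before_def f_def ccube_def)
  also have "\<dots> \<in> sets (F q)" by measurable
  finally show ?thesis .
qed

text \<open>Being outside a closed cube is an open condition, so a path outside at time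
  \<open>s\<close> is still outside at some rational time slightly later. This time exceeds
  \<open>\<tau> k \<omega>\<close>, hence the centre is already known there and each set of the
  countable union is decided at time \<open>q\<close>.\<close>

lemma before_Suc:
  assumes t: "t \<in> {0..T}"
  shows "before (Suc k) t =
    (\<Union>q\<in>\<rat> \<inter> {0..<t}. {\<omega> \<in> before k q. S q \<omega> \<notin> ccube (X k \<omega>) (rad (X k \<omega>))})"
proof (intro equalityI subsetI)
  fix \<omega> assume "\<omega> \<in> before (Suc k) t"
  then have \<omega>: "\<omega> \<in> space M" and "exit (\<tau> k \<omega>) (X k \<omega>) \<omega> < t"
    by (auto simp: before_def \<tau>_Suc)
  then obtain s where s: "\<tau> k \<omega> < s" "0 \<le> s" "s < t" "S s \<omega> \<in> - ccube (X k \<omega>) (rad (X k \<omega>))"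
    using exit_less_iff[of t "\<tau> k \<omega>" "X k \<omega>" \<omega>] t by auto
  have "s < T" using s t by auto
  then obtain e where e: "e > 0" "s + e \<le> T"
      "\<And>u. s \<le> u \<Longrightarrow> u < s + e \<Longrightarrow> S u \<omega> \<in> - ccube (X k \<omega>) (rad (X k \<omega>))"
    using near_right[OF \<omega> s(2) _ open_Compl[OF closed_ccube] s(4)] by blast
  obtain q where q: "q \<in> \<rat>" "s < q" "q < min t (s + e)"
    using Rats_dense_in_real[of s "min t (s + e)"] s e by auto
  have "S q \<omega> \<notin> ccube (X k \<omega>) (rad (X k \<omega>))" using e(3)[of q] q by auto
  then show "\<omega> \<in> (\<Union>q\<in>\<rat> \<inter> {0..<t}. {\<omega> \<in> before k q. S q \<omega> \<notin> ccube (X k \<omega>) (rad (X k \<omega>))})"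
    using q s \<omega> by (auto simp: before_def intro!: bexI[of _ q])
next
  fix \<omega> assume "\<omega> \<in> (\<Union>q\<in>\<rat> \<inter> {0..<t}. {\<omega> \<in> before k q. S q \<omega> \<notin> ccube (X k \<omega>) (rad (X k \<omega>))})"
  then show "\<omega> \<in> before (Suc k) t"
    using exit_less_iff[of t "\<tau> k \<omega>" "X k \<omega>" \<omega>] t by (auto simp: before_def \<tau>_Suc)
qed

lemma H_sets_mono:
  assumes "\<And>t. t \<in> {0..T} \<Longrightarrow> before (Suc k) t \<in> sets (F t)"
  shows "H_sets k \<subseteq> H_sets (Suc k)"
proof
  fix A assume A: "A \<in> H_sets k"
  have "A \<inter> before (Suc k) t = (A \<inter> before k t) \<inter> before (Suc k) t" for t
    by (auto simp: before_def intro: le_less_trans[OF \<tau>_Suc_ge])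
  then show "A \<in> H_sets (Suc k)" using A assms by (auto simp: H_sets_def)
qed

lemma lab_meas_aux:
  assumes b: "\<And>t. t \<in> {0..T} \<Longrightarrow> before (Suc k) t \<in> sets (F t)"
    and X: "X k \<in> borel_measurable (H (Suc k))"
  shows "lab k \<in> borel_measurable (H (Suc k))"
proof -
  define Y where "Y \<omega> = (if \<tau> (Suc k) \<omega> < T then S (max (\<tau> (Suc k) \<omega>) 0) \<omega> else 0)" for \<omega>
  have "Y \<in> borel_measurable (F T)"
    unfolding Y_def[abs_def] using S_\<tau>_restrict[OF b, of T] T_pos by auto
  then have "Y \<in> borel_measurable M" using subalg_F[of T] T_pos measurable_from_subalg by auto
  moreover have "(\<lambda>\<omega>. if \<tau> (Suc k) \<omega> < t then Y \<omega> else 0) \<in> borel_measurable (F t)" if "t \<in> {0..T}" for t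
  proof -
    have "(\<lambda>\<omega>. if \<tau> (Suc k) \<omega> < t then Y \<omega> else 0) =
      (\<lambda>\<omega>. if \<tau> (Suc k) \<omega> < t then S (max (\<tau> (Suc k) \<omega>) 0) \<omega> else 0)"
      using that by (auto simp: Y_def)
    then show ?thesis using S_\<tau>_restrict[OF b that] by simp
  qed
  ultimately have [measurable]: "Y \<in> borel_measurable (H (Suc k))" by (intro H_restrictI[OF b])
  have "before (Suc k) T \<in> H_sets (Suc k)"
  proof -
    have "before (Suc k) T \<inter> before (Suc k) t = before (Suc k) t" if "t \<in> {0..T}" for t
      using that by (auto simp: before_def)
    then show ?thesis using b sets_F_M[of T] T_pos by (auto simp: H_sets_def)
  qed
  then have [measurable]: "before (Suc k) T \<in> sets (H (Suc k))" using sets_H_aux[OF b] by simp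
  have [measurable]: "X k \<in> borel_measurable (H (Suc k))" by (rule X)
  have "(\<lambda>\<omega>. if \<omega> \<in> before (Suc k) T then round_vec ((Y \<omega> - X k \<omega>) /\<^sub>R rad (X k \<omega>)) else 0)
      \<in> borel_measurable (H (Suc k))" by measurable
  then show ?thesis
  proof (rule measurable_cong[THEN iffD1, rotated])
    fix \<omega> assume "\<omega> \<in> space (H (Suc k))"
    moreover have "max (\<tau> (Suc k) \<omega>) 0 = \<tau> (Suc k) \<omega>"
      using exit_nonneg[of "\<tau> k \<omega>" "X k \<omega>" \<omega>] by (simp add: \<tau>_Suc)
    ultimately show "(if \<omega> \<in> before (Suc k) T then round_vec ((Y \<omega> - X k \<omega>) /\<^sub>R rad (X k \<omega>)) else 0) = lab k \<omega>"
      unfolding lab_eq Y_def by (auto simp: before_def space_H)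
  qed
qed

text \<open>Both claims must go through one induction: the events of the next exit time are
  described through the current centre, and the next centre is measurable only once the sets known
  at the next exit form a sigma-algebra.\<close>

lemma before_X_measurable:
  "(\<forall>t\<in>{0..T}. before k t \<in> sets (F t)) \<and> X k \<in> borel_measurable (H k)"
proof (induction k)
  case 0
  have b: "before 0 t = space (F t)" if "t \<in> {0..T}" for t
    using that space_F by (auto simp: before_def)
  then have b': "before 0 t \<in> sets (F t)" if "t \<in> {0..T}" for t using that by simp
  have X0: "X0 \<in> borel_measurable (F t)" if "t \<in> {0..T}" for t
    using measurable_F_mono[OF _ _ _ X0_meas] that by auto
  have "X0 \<in> borel_measurable M" using X0_meas subalg_F[of 0] T_pos measurable_from_subalg by auto
  moreover have "(\<lambda>\<omega>. if \<tau> 0 \<omega> < t then X0 \<omega> else 0) \<in> borel_measurable (F t)" if "t \<in> {0..T}" for t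
    using that X0 by auto
  ultimately have "X0 \<in> borel_measurable (H 0)" by (intro H_restrictI[OF b']) auto
  moreover have "X 0 = X0" by auto
  ultimately show ?case using b' by auto
next
  case (Suc k)
  then have b: "\<And>t. t \<in> {0..T} \<Longrightarrow> before k t \<in> sets (F t)" and X: "X k \<in> borel_measurable (H k)" by auto
  have b': "before (Suc k) t \<in> sets (F t)" if t: "t \<in> {0..T}" for t
    unfolding before_Suc[OF t]
  proof (intro sets.countable_UN'')
    show "countable (\<rat> \<inter> {0..<t})" using countable_rat by blast
    fix q assume "q \<in> \<rat> \<inter> {0..<t}"
    then show "{\<omega> \<in> before k q. S q \<omega> \<notin> ccube (X k \<omega>) (rad (X k \<omega>))} \<in> sets (F t)"
      using H_pred[OF b X, of q] F_mono[of q t] t by auto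
  qed
  have sub: "sets (H k) \<subseteq> sets (H (Suc k))"
    using H_sets_mono[OF b'] sets_H_aux[OF b] sets_H_aux[OF b'] by simp
  have [measurable]: "X k \<in> borel_measurable (H (Suc k))"
    using X sub space_H[of k] space_H[of "Suc k"] by (auto simp: measurable_def)
  have [measurable]: "lab k \<in> borel_measurable (H (Suc k))"
    by (rule lab_meas_aux[OF b']) measurable
  have "(\<lambda>\<omega>. X k \<omega> + rad (X k \<omega>) *\<^sub>R lab k \<omega>) \<in> borel_measurable (H (Suc k))" by measurable
  moreover have "X (Suc k) = (\<lambda>\<omega>. X k \<omega> + rad (X k \<omega>) *\<^sub>R lab k \<omega>)" by (auto simp: X_Suc)
  ultimately show ?case using b' by simp
qed

lemma before_sets_F: "t \<in> {0..T} \<Longrightarrow> before k t \<in> sets (F t)"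
  and X_meas_H [measurable]: "X k \<in> borel_measurable (H k)"
  using before_X_measurable by auto

lemma sets_H: "sets (H k) = H_sets k"
  by (rule sets_H_aux[OF before_sets_F])

lemma subalg_H: "subalgebra M (H k)"
  by (auto simp: subalgebra_def space_H sets_H H_sets_def)

lemma measurable_H_M: "f \<in> measurable (H k) N \<Longrightarrow> f \<in> measurable M N"
  using subalg_H by (rule measurable_from_subalg)

lemma sets_H_mono: "j \<le> k \<Longrightarrow> sets (H j) \<subseteq> sets (H k)"
proof (rule lift_Suc_mono_le[of "\<lambda>k. sets (H k)"])
  show "sets (H n) \<subseteq> sets (H (Suc n))" for n
    unfolding sets_H by (rule H_sets_mono) (rule before_sets_F)
qed

lemma measurable_H_mono: "j \<le> k \<Longrightarrow> f \<in> measurable (H j) N \<Longrightarrow> f \<in> measurable (H k) N"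
  using sets_H_mono[of j k] by (auto simp: measurable_def space_H)

lemma lab_meas_H: "lab k \<in> borel_measurable (H (Suc k))"
  by (intro lab_meas_aux before_sets_F measurable_H_mono[OF _ X_meas_H]) auto

lemma before_T_sets_H [measurable]: "before k T \<in> sets (H k)"
proof -
  have "before k T \<inter> before k t = before k t" if "t \<in> {0..T}" for t
    using that by (auto simp: before_def)
  then show ?thesis using before_sets_F sets_F_M[of T] T_pos by (auto simp: sets_H H_sets_def)
qed

text \<open>On \<open>A\<close> the exit time is at least \<open>t\<close>, so what is known at
  \<open>t\<close> is known at that exit. This links events at fixed times to the walk.\<close>

lemma F_sets_in_H:
  assumes "t \<in> {0..T}" "A \<in> sets (F t)" "A \<inter> before k t = {}"
  shows "A \<in> sets (H k)"
proof -
  have "A \<inter> before k u \<in> sets (F u)" if u: "u \<in> {0..T}" for u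
  proof (cases "u \<le> t")
    case True
    then have "A \<inter> before k u = {}" using assms(3) by (auto simp: before_def)
    then show ?thesis by simp
  next
    case False
    then show ?thesis using F_mono[of t u] assms u before_sets_F[OF u] by auto
  qed
  then show ?thesis using sets_F_M assms by (auto simp: sets_H H_sets_def)
qed

text \<open>Countability allows events to be split by the value of the centre, with null sets
  collected over all values.\<close>

lemma countable_X: "countable (X k ` space M)"
proof (induction k)
  case 0
  then show ?case using countable_X0 by simp
next
  case (Suc k)
  have "X (Suc k) ` space M \<subseteq> (\<lambda>(x, d). x + rad x *\<^sub>R d) ` (X k ` space M \<times> grid)"
    using lab_in_grid by (force simp: X_Suc)
  then show ?case
    by (rule countable_subset) (intro countable_image countable_SIGMA Suc countable_finite finite_grid)
qed

section \<open>Positivity of the displacement probabilities\<close>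

text \<open>The path is unconstrained before \<open>q\<close> apart from lying in \<open>Ob\<close>,
  so every observed past ending in \<open>W\<close> is a candidate for continuation inside the
  tube.\<close>

definition tube :: "real \<Rightarrow> (real ^ 'n) set \<Rightarrow> (real ^ 'n) set \<Rightarrow> (real \<Rightarrow> real ^ 'n) set" where
  "tube q W U = {g \<in> path_space T Ob. (\<forall>s\<in>{q..T}. g s \<in> W) \<and> g T \<in> U}"

lemma uniform_open_tube:
  assumes q: "0 \<le> q" "q \<le> T" and W: "open W" and U: "open U"
  shows "uniform_open T Ob (tube q W U)"
  unfolding uniform_open_def
proof (intro conjI ballI)
  show "tube q W U \<subseteq> path_space T Ob" by (auto simp: tube_def)
  fix g assume g: "g \<in> tube q W U"
  have "compact (g ` {q..T})"
    using g q by (intro compact_continuous_image)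
      (auto simp: tube_def path_space_def intro: continuous_on_subset)
  moreover have "g ` {q..T} \<subseteq> W" using g by (auto simp: tube_def)
  ultimately obtain e1 where e1: "e1 > 0" "(\<Union>x\<in>g ` {q..T}. ball x e1) \<subseteq> W"
    using compact_subset_open_imp_ball_epsilon_subset[OF _ W] by metis
  obtain e2 where e2: "e2 > 0" "ball (g T) e2 \<subseteq> U"
    using U g by (auto simp: tube_def elim: openE)
  show "\<exists>e>0. \<forall>h\<in>path_space T Ob. (\<forall>t\<in>{0..T}. dist (h t) (g t) < e) \<longrightarrow>
      (\<exists>g'\<in>tube q W U. \<forall>t\<in>{0..T}. g' t = h t)"
  proof (intro exI[of _ "min e1 e2"] conjI ballI impI)
    show "0 < min e1 e2" using e1 e2 by simp
    fix h assume h: "h \<in> path_space T Ob" and near: "\<forall>t\<in>{0..T}. dist (h t) (g t) < min e1 e2"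
    have "h s \<in> W" if "s \<in> {q..T}" for s
    proof -
      have "h s \<in> ball (g s) e1" using near that q by (auto simp: dist_commute)
      then show ?thesis using e1(2) that by blast
    qed
    moreover have "h T \<in> ball (g T) e2" using near q by (auto simp: dist_commute)
    ultimately have "h \<in> tube q W U" using h e2(2) by (auto simp: tube_def)
    then show "\<exists>g'\<in>tube q W U. \<forall>t\<in>{0..T}. g' t = h t" by blast
  qed
qed

lemma path_event_tube:
  assumes q: "0 \<le> q" "q \<le> T"
  shows "path_event M T S (tube q W U) = {\<omega> \<in> space M. (\<forall>s\<in>{q..T}. S s \<omega> \<in> W) \<and> S T \<omega> \<in> U}"
proof (intro equalityI subsetI)
  fix \<omega> assume "\<omega> \<in> path_event M T S (tube q W U)"
  then obtain g where "\<omega> \<in> space M" "g \<in> tube q W U" "\<And>t. t \<in> {0..T} \<Longrightarrow> g t = S t \<omega>"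
    by (auto simp: path_event_def)
  then show "\<omega> \<in> {\<omega> \<in> space M. (\<forall>s\<in>{q..T}. S s \<omega> \<in> W) \<and> S T \<omega> \<in> U}"
    using q by (auto simp: tube_def)
next
  fix \<omega> assume "\<omega> \<in> {\<omega> \<in> space M. (\<forall>s\<in>{q..T}. S s \<omega> \<in> W) \<and> S T \<omega> \<in> U}"
  then have \<omega>: "\<omega> \<in> space M" "\<forall>s\<in>{q..T}. S s \<omega> \<in> W" "S T \<omega> \<in> U" by blast+
  then have "(\<lambda>t. S t \<omega>) \<in> tube q W U"
    unfolding tube_def path_space_def using S_cont[OF \<omega>(1)] S_in[OF _ \<omega>(1)] by blast
  with \<omega>(1) show "\<omega> \<in> path_event M T S (tube q W U)"
    unfolding path_event_def mem_Collect_eq by (intro conjI bexI[of _ "\<lambda>t. S t \<omega>"] ballI refl)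
qed

text \<open>By compactness a path that stays in an open set keeps a positive distance from its
  complement. The weak inequality for this distance can then be tested at rational times. The time
  \<open>T\<close> is added by hand, since rationals are approached from the right.\<close>

lemma stays_in_open_iff:
  assumes \<omega>: "\<omega> \<in> space M" and q: "0 \<le> q" "q \<le> T" and W: "open W" "W \<noteq> UNIV"
  shows "(\<forall>s\<in>{q..T}. S s \<omega> \<in> W) \<longleftrightarrow>
    (\<exists>m. \<forall>s\<in>insert T (\<rat> \<inter> {q..T}). 1 / real (Suc m) \<le> infdist (S s \<omega>) (- W))"
proof
  assume *: "\<forall>s\<in>{q..T}. S s \<omega> \<in> W"
  have "continuous_on {q..T} (\<lambda>s. infdist (S s \<omega>) (- W))"
    using q by (intro continuous_intros continuous_on_subset[OF S_cont[OF \<omega>]]) auto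
  then obtain s0 where s0: "s0 \<in> {q..T}" "\<And>s. s \<in> {q..T} \<Longrightarrow> infdist (S s0 \<omega>) (- W) \<le> infdist (S s \<omega>) (- W)"
    using continuous_attains_inf[of "{q..T}" "\<lambda>s. infdist (S s \<omega>) (- W)"] q by auto
  have "infdist (S s0 \<omega>) (- W) > 0"
    using s0 * W by (intro infdist_pos_not_in_closed) auto
  then obtain m where "1 / real (Suc m) < infdist (S s0 \<omega>) (- W)"
    using nat_approx_posE by blast
  then show "\<exists>m. \<forall>s\<in>insert T (\<rat> \<inter> {q..T}). 1 / real (Suc m) \<le> infdist (S s \<omega>) (- W)"
    using s0 q by (intro exI[of _ m] ballI) (force intro: less_imp_le[OF less_le_trans])
next
  assume "\<exists>m. \<forall>s\<in>insert T (\<rat> \<inter> {q..T}). 1 / real (Suc m) \<le> infdist (S s \<omega>) (- W)"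
  then obtain m where m: "\<And>s. s \<in> insert T (\<rat> \<inter> {q..T}) \<Longrightarrow> 1 / real (Suc m) \<le> infdist (S s \<omega>) (- W)"
    by blast
  show "\<forall>s\<in>{q..T}. S s \<omega> \<in> W"
  proof (rule ballI, rule ccontr)
    fix s assume s: "s \<in> {q..T}" "S s \<omega> \<notin> W"
    then have 0: "infdist (S s \<omega>) (- W) = 0" by simp
    show False
    proof (cases "s = T")
      case True
      have "0 < 1 / real (Suc m)" by simp
      moreover have "1 / real (Suc m) \<le> infdist (S T \<omega>) (- W)" by (rule m) simp
      ultimately show False using 0 True by simp
    next
      case False
      let ?V = "{y. infdist y (- W) < 1 / real (Suc m)}"
      have "open ?V" by (intro open_Collect_less continuous_intros)
      moreover have "S s \<omega> \<in> ?V" using 0 by simp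
      ultimately obtain e where e: "e > 0" "s + e \<le> T" "\<And>u. s \<le> u \<Longrightarrow> u < s + e \<Longrightarrow> S u \<omega> \<in> ?V"
        using near_right[OF \<omega>, of s ?V] s q False by auto
      obtain u where "u \<in> \<rat>" "s < u" "u < s + e"
        using Rats_dense_in_real[of s "s + e"] e(1) by auto
      then show False using m[of u] e(2) e(3)[of u] s by auto
    qed
  qed
qed

lemma path_event_tube_sets:
  assumes q: "0 \<le> q" "q \<le> T" and W: "open W" "W \<noteq> UNIV" and U: "open U"
  shows "path_event M T S (tube q W U) \<in> sets M"
proof -
  let ?D = "insert T (\<rat> \<inter> {q..T})"
  have 1: "{\<omega> \<in> space M. 1 / real (Suc m) \<le> infdist (S s \<omega>) (- W)} \<in> sets M" if "s \<in> ?D" for m s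
  proof -
    have [measurable]: "S s \<in> borel_measurable M" using that q by (intro S_meas_M) auto
    have "(\<lambda>y. infdist y (- W)) \<in> borel_measurable borel"
      by (intro borel_measurable_continuous_onI continuous_intros)
    note [measurable] = measurable_compose[OF \<open>S s \<in> borel_measurable M\<close> this]
    show ?thesis by measurable
  qed
  have [measurable]: "S T \<in> borel_measurable M" "U \<in> sets borel"
    using q U by (auto intro: S_meas_M)
  have cD: "countable ?D" using countable_rat by auto
  have "path_event M T S (tube q W U) =
    (\<Union>m. \<Inter>s\<in>?D. {\<omega> \<in> space M. 1 / real (Suc m) \<le> infdist (S s \<omega>) (- W)}) \<inter> {\<omega> \<in> space M. S T \<omega> \<in> U}"
    unfolding path_event_tube[OF q] using stays_in_open_iff[OF _ q W] by auto
  also have "\<dots> \<in> sets M"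
  proof (intro sets.Int sets.countable_UN'')
    show "(\<Inter>s\<in>?D. {\<omega> \<in> space M. 1 / real (Suc m) \<le> infdist (S s \<omega>) (- W)}) \<in> sets M" for m
      by (rule sets.countable_INT'[OF cD]) (use 1 in auto)
  qed auto
  finally show ?thesis .
qed

text \<open>Glueing the observed path to the given continuation shows that every past in
  \<open>B\<close> is the past of a path in the tube. So the conditional probability of the tube is
  positive almost everywhere on \<open>B\<close>, and its integral over \<open>B\<close> cannot
  vanish unless \<open>B\<close> is null.\<close>

lemma cfs_tube:
  assumes q: "0 \<le> q" "q < T" and W: "open W" "W \<noteq> UNIV" "W \<subseteq> Ob" and U: "open U"
    and B: "B \<in> sets (F q)" "emeasure M B \<noteq> 0"
    and ext: "\<And>\<omega>. \<omega> \<in> B \<Longrightarrow> \<exists>h. continuous_on {q..T} h \<and> h q = S q \<omega> \<and> (\<forall>s\<in>{q..T}. h s \<in> W) \<and> h T \<in> U"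
  shows "emeasure M (B \<inter> path_event M T S (tube q W U)) \<noteq> 0"
proof
  let ?E = "path_event M T S (tube q W U)"
  assume null: "emeasure M (B \<inter> ?E) = 0"
  have qT: "q \<in> {0..T}" "q \<le> T" using q by auto
  interpret Fq: finite_measure_subalgebra M "F q"
    by unfold_locales (rule subalg_F[OF qT(1)])
  have [measurable]: "?E \<in> sets M" using path_event_tube_sets[OF q(1) qT(2) W(1,2) U] .
  have [measurable]: "B \<in> sets M" using B sets_F_M[OF qT(1)] by auto
  let ?r = "real_cond_exp M (F q) (indicator ?E)"
  have ex: "\<exists>g\<in>tube q W U. \<forall>s\<in>{0..q}. g s = S s \<omega>" if \<omega>: "\<omega> \<in> B" for \<omega>
  proof -
    have sp: "\<omega> \<in> space M" using \<omega> sets.sets_into_space[OF \<open>B \<in> sets M\<close>] by auto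
    obtain h where h: "continuous_on {q..T} h" "h q = S q \<omega>" "\<And>s. s \<in> {q..T} \<Longrightarrow> h s \<in> W" "h T \<in> U"
      using ext[OF \<omega>] by blast
    define g where "g s = (if s \<le> q then S s \<omega> else h s)" for s
    have "continuous_on ({0..q} \<union> {q..T}) g"
      unfolding g_def
    proof (rule continuous_on_cases)
      show "continuous_on {0..q} (\<lambda>s. S s \<omega>)"
        using qT by (intro continuous_on_subset[OF S_cont[OF sp]]) auto
    qed (use h in auto)
    moreover have "{0..q} \<union> {q..T} = {0..T}" using q by auto
    ultimately have "continuous_on {0..T} g" by simp
    moreover have gW: "g s \<in> W" if "s \<in> {q..T}" for s
      using h(2) h(3)[of s] h(3)[of q] that q by (auto simp: g_def)
    moreover have "g s \<in> Ob" if "s \<in> {0..T}" for s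
      using S_in[OF that sp] gW[of s] W(3) that by (cases "s \<le> q") (auto simp: g_def)
    moreover have "g T \<in> U" using h(4) q by (simp add: g_def)
    ultimately have "g \<in> tube q W U" by (auto simp: tube_def path_space_def)
    then show ?thesis by (intro bexI[of _ g]) (auto simp: g_def)
  qed
  have "AE \<omega> in M. (\<exists>g\<in>tube q W U. \<forall>s\<in>{0..q}. g s = S s \<omega>) \<longrightarrow> ?r \<omega> > 0"
    using S_cfs uniform_open_tube[OF q(1) qT(2) W(1) U] qT(1) unfolding cond_full_support_def by blast
  then have pos: "AE \<omega> in M. \<omega> \<in> B \<longrightarrow> ?r \<omega> > 0" by eventually_elim (use ex in auto)
  have int: "integrable M (indicator ?E :: 'a \<Rightarrow> real)"
    by (intro integrable_real_indicator) (simp_all add: less_top[symmetric])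
  have "(\<integral>\<omega>. indicator B \<omega> * ?r \<omega> \<partial>M) = (\<integral>\<omega>. indicator B \<omega> * indicator ?E \<omega> \<partial>M)"
    using Fq.real_cond_exp_intA[OF int B(1)] by (simp add: set_lebesgue_integral_def)
  also have "\<dots> = measure M (B \<inter> ?E)"
    by (simp add: indicator_inter_arith[symmetric])
  also have "\<dots> = 0" using null by (simp add: measure_def)
  finally have "(\<integral>\<omega>. indicator B \<omega> * ?r \<omega> \<partial>M) = 0" .
  moreover have "integrable M (\<lambda>\<omega>. indicator B \<omega> * ?r \<omega>)"
    by (intro integrable_real_mult_indicator[of B M ?r, simplified mult.commute]) (auto intro: Fq.real_cond_exp_int int)
  moreover have "AE \<omega> in M. 0 \<le> indicator B \<omega> * ?r \<omega>"
    using pos by eventually_elim (auto simp: indicator_def)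
  ultimately have "AE \<omega> in M. indicator B \<omega> * ?r \<omega> = 0"
    using integral_nonneg_eq_0_iff_AE by blast
  with pos have "AE \<omega> in M. \<omega> \<notin> B" by eventually_elim (auto simp: indicator_def split: if_splits)
  then show False using B(2) \<open>B \<in> sets M\<close> by (simp add: AE_iff_measurable[OF \<open>B \<in> sets M\<close>] sets.sets_into_space Int_absorb1 Int_def[symmetric])
qed

lemma tube_path:
  fixes x d a :: "real ^ 'n"
  assumes "q < T" "r > 0" "d \<in> grid" and a: "a \<in> ocube x r"
  shows "\<exists>h. continuous_on {q..T} h \<and> h q = a \<and>
    (\<forall>s\<in>{q..T}. h s \<in> ocube x r \<union> ocube (x + r *\<^sub>R d) (r/2)) \<and>
    h T \<in> (if d = 0 then UNIV else - ccube x r)"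
proof -
  \<comment> \<open>With factor 3/4 the first point lies in both open cubes and joins them; with
    factor 5/4 the second one is still within r / 2 of \<open>x + r *\<^sub>R d\<close> but outside
    the large cube when \<open>d\<close> is nonzero. Convexity keeps the two segments
    inside.\<close>
  define p1 where "p1 = x + (3/4 * r) *\<^sub>R d"
  define p2 where "p2 = x + (5/4 * r) *\<^sub>R d"
  have le: "\<bar>r * d $ i\<bar> \<le> r" for i
    using abs_grid_le[OF assms(3), of i] assms(2) by (simp add: abs_mult mult_le_cancel_left1)
  have p1: "p1 \<in> ocube x r" "p1 \<in> ocube (x + r *\<^sub>R d) (r/2)"
    and p2: "p2 \<in> ocube (x + r *\<^sub>R d) (r/2)"
  proof -
    have "\<bar>p1 $ i - x $ i\<bar> < r" for i using le[of i] assms(2) by (simp add: p1_def abs_le_iff abs_less_iff)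
    then show "p1 \<in> ocube x r" by (simp add: ocube_def)
    have "\<bar>p1 $ i - (x + r *\<^sub>R d) $ i\<bar> < r / 2" for i
      using le[of i] assms(2) by (simp add: p1_def abs_le_iff abs_less_iff)
    then show "p1 \<in> ocube (x + r *\<^sub>R d) (r/2)" unfolding ocube_def by blast
    have "\<bar>p2 $ i - (x + r *\<^sub>R d) $ i\<bar> < r / 2" for i
      using le[of i] assms(2) by (simp add: p2_def abs_le_iff abs_less_iff)
    then show "p2 \<in> ocube (x + r *\<^sub>R d) (r/2)" unfolding ocube_def by blast
  qed
  have p2': "p2 \<notin> ccube x r" if "d \<noteq> 0"
  proof -
    obtain i where "\<bar>d $ i\<bar> = 1" by (rule grid_abs_eq_one[OF assms(3) \<open>d \<noteq> 0\<close>])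
    then have "\<bar>p2 $ i - x $ i\<bar> = 5/4 * r" using assms(2) by (simp add: p2_def abs_mult)
    then show ?thesis using assms(2) by (auto simp: ccube_def not_le intro!: exI[of _ i])
  qed
  define h where "h s = (linepath a p1 +++ linepath p1 p2) ((s - q) / (T - q))" for s
  have "path (linepath a p1 +++ linepath p1 p2)" by simp
  then have c: "continuous_on {0..1} (linepath a p1 +++ linepath p1 p2)" by (simp add: path_def)
  have "continuous_on {q..T} h"
    unfolding h_def
    by (rule continuous_on_compose2[OF c]) (use assms(1) in \<open>auto intro!: continuous_intros simp: divide_simps\<close>)
  moreover have "h q = a" "h T = p2"
    using assms(1) pathstart_join[of "linepath a p1" "linepath p1 p2"]
      pathfinish_join[of "linepath a p1" "linepath p1 p2"]
    by (auto simp: h_def pathstart_def pathfinish_def linepath_def)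
  moreover have "h s \<in> ocube x r \<union> ocube (x + r *\<^sub>R d) (r/2)" if "s \<in> {q..T}" for s
  proof -
    have "(s - q) / (T - q) \<in> {0..1}" using that assms(1) by auto
    then have "h s \<in> path_image (linepath a p1 +++ linepath p1 p2)"
      unfolding h_def path_image_def by blast
    also have "\<dots> = closed_segment a p1 \<union> closed_segment p1 p2" by (subst path_image_join) auto
    also have "\<dots> \<subseteq> ocube x r \<union> ocube (x + r *\<^sub>R d) (r/2)"
      by (intro Un_mono closed_segment_subset a p1 p2 convex_ocube)
    finally show ?thesis .
  qed
  ultimately show ?thesis using p2' by (intro exI[of _ h]) auto
qed

text \<open>Conditional full support speaks of fixed times, so \<open>A\<close> is cut into
  countably many pieces \<open>B q x\<close> on which the centre is \<open>x\<close> and the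
  rational \<open>q\<close> lies between the two exits; one piece is not null. From \<open>q\<close>
  on, the path is confined to the cube and a half-size cube around \<open>x + r *\<^sub>R d\<close>.
  An exit must then occur in the small cube, where rounding returns \<open>d\<close>. For nonzero
  \<open>d\<close> the endpoint outside the cube forces an exit before \<open>T\<close>; for
  \<open>d = 0\<close> an outcome without exit is labelled correctly anyway.\<close>

lemma lab_reaches:
  assumes d: "d \<in> grid" and A: "A \<in> sets (H k)" "A \<subseteq> before k T" "emeasure M A \<noteq> 0"
  shows "emeasure M (A \<inter> {\<omega> \<in> space M. lab k \<omega> = d}) \<noteq> 0"
proof -
  define B where "B q x = A \<inter> {\<omega> \<in> space M. X k \<omega> = x} \<inter> before k q \<inter> (space M - before (Suc k) q)
      \<inter> {\<omega> \<in> space M. S q \<omega> \<in> ocube x (rad x)}" for q x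
  have AM: "A \<in> sets M" using A subalg_H by (auto simp: subalgebra_def)
  have B_sets: "B q x \<in> sets (F q)" if q: "q \<in> {0..T}" for q x
  proof -
    have "{\<omega> \<in> space M. X k \<omega> = x} \<in> sets (H k)"
      using measurable_sets[OF X_meas_H, of "{x}" k] by (simp add: space_H vimage_def Int_def conj_commute)
    then have "A \<inter> {\<omega> \<in> space M. X k \<omega> = x} \<in> H_sets k" using A(1) sets_H[of k] by auto
    then have 1: "A \<inter> {\<omega> \<in> space M. X k \<omega> = x} \<inter> before k q \<in> sets (F q)" using q by (simp add: H_sets_def)
    have 2: "space M - before (Suc k) q \<in> sets (F q)"
      using before_sets_F[OF q] space_F[OF q] by (metis sets.compl_sets)
    have "S q -` ocube x (rad x) \<inter> space (F q) \<in> sets (F q)"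
      using S_adapted[OF q] open_ocube[of x "rad x"] by (intro measurable_sets[of _ _ borel] borel_open)
    then have 3: "{\<omega> \<in> space M. S q \<omega> \<in> ocube x (rad x)} \<in> sets (F q)"
      using space_F[OF q] by (simp add: vimage_def Int_def conj_commute)
    show ?thesis unfolding B_def by (rule sets.Int[OF sets.Int[OF 1 2] 3])
  qed
  have cover: "A \<subseteq> (\<Union>q\<in>\<rat> \<inter> {0..<T}. \<Union>x\<in>X k ` space M. B q x)"
  proof
    fix \<omega> assume \<omega>A: "\<omega> \<in> A"
    then have \<omega>: "\<omega> \<in> space M" "\<tau> k \<omega> < T" using A(2) by (auto simp: before_def)
    let ?u = "max (\<tau> k \<omega>) 0"
    have u: "?u < T" "0 \<le> ?u" using \<omega> T_pos by auto
    obtain e where e: "e > 0" "?u + e \<le> T"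
        "\<And>s. ?u \<le> s \<Longrightarrow> s < ?u + e \<Longrightarrow> S s \<omega> \<in> ocube (X k \<omega>) (rad (X k \<omega>))"
      using near_right[OF \<omega>(1) u(2,1) open_ocube S_\<tau>_ocube[OF \<omega>]] by blast
    \<comment> \<open>Both bounds matter: before \<open>?u + e\<close> the path is in the open cube,
      from which the tube can be entered, and before the next exit the displacement is still
      undecided.\<close>
    have "?u < min (?u + e) (\<tau> (Suc k) \<omega>)" using e(1) \<tau>_Suc_gt[OF \<omega>] by simp
    then obtain q where q: "q \<in> \<rat>" "?u < q" "q < min (?u + e) (\<tau> (Suc k) \<omega>)"
      using Rats_dense_in_real by blast
    then have "\<omega> \<in> B q (X k \<omega>)"
      using e(3)[of q] \<omega> \<omega>A by (auto simp: B_def before_def)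
    moreover have "q \<in> \<rat> \<inter> {0..<T}" using q e(2) by auto
    ultimately show "\<omega> \<in> (\<Union>q\<in>\<rat> \<inter> {0..<T}. \<Union>x\<in>X k ` space M. B q x)" using \<omega> by blast
  qed
  have "\<exists>q\<in>\<rat> \<inter> {0..<T}. \<exists>x\<in>X k ` space M. emeasure M (B q x) \<noteq> 0"
  proof (rule ccontr)
    assume neg: "\<not> ?thesis"
    have "(\<Union>q\<in>\<rat> \<inter> {0..<T}. \<Union>x\<in>X k ` space M. B q x) \<in> null_sets M"
    proof (intro null_sets_UN' countable_X)
      show "countable (\<rat> \<inter> {0..<T})" using countable_rat by auto
      fix q x assume "q \<in> \<rat> \<inter> {0..<T}" "x \<in> X k ` space M"
      then show "B q x \<in> null_sets M"
        using neg B_sets[of q x] sets_F_M[of q] by (intro null_setsI) auto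
    qed
    then have "A \<in> null_sets M" using null_sets_subset[OF _ AM cover] by blast
    then show False using A(3) by auto
  qed
  then obtain q x where q: "q \<in> \<rat>" "0 \<le> q" "q < T" and x: "x \<in> X k ` space M"
    and Bq: "emeasure M (B q x) \<noteq> 0" by (metis IntE atLeastLessThan_iff)
  have xO: "x \<in> Ob" using x X_in by auto
  define r where "r = rad x"
  have r: "r > 0" using rad_pos[OF xO] by (simp add: r_def)
  define W where "W = ocube x r \<union> ocube (x + r *\<^sub>R d) (r/2)"
  define U where "U = (if d = 0 then UNIV else - ccube x r)"
  have "W \<subseteq> ccube x (2 * r)"
  proof -
    have "\<bar>y $ i - x $ i\<bar> \<le> 2 * r" if "y \<in> ocube (x + r *\<^sub>R d) (r/2)" for y i
    proof -
      have "\<bar>r * d $ i\<bar> \<le> r"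
        using abs_grid_le[OF d, of i] r by (simp add: abs_mult mult_le_cancel_left1)
      moreover have "\<bar>y $ i - (x $ i + r * d $ i)\<bar> < r / 2" using that by (simp add: ocube_def)
      ultimately show ?thesis using r by linarith
    qed
    moreover have "ocube x r \<subseteq> ccube x (2 * r)"
      using ocube_subset_ccube[of x r] ccube_mono[of r "2 * r" x] r by auto
    ultimately show ?thesis unfolding W_def by (auto simp: ccube_def)
  qed
  then have WO: "W \<subseteq> Ob" using ccube_subset[OF xO] by (simp add: r_def)
  then have WU: "W \<noteq> UNIV" using Ob_ne_UNIV by auto
  have oW: "open W" and oU: "open U"
    unfolding W_def U_def by (auto intro: open_Un open_ocube closed_ccube open_Compl)
  let ?E = "path_event M T S (tube q W U)"
  have qT: "q \<in> {0..T}" "q \<le> T" using q by auto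
  have BE: "emeasure M (B q x \<inter> ?E) \<noteq> 0"
  proof (rule cfs_tube[OF q(2,3) oW WU WO oU B_sets[OF qT(1)] Bq])
    fix \<omega> assume "\<omega> \<in> B q x"
    then have "S q \<omega> \<in> ocube x r" by (simp add: B_def r_def)
    then show "\<exists>h. continuous_on {q..T} h \<and> h q = S q \<omega> \<and> (\<forall>s\<in>{q..T}. h s \<in> W) \<and> h T \<in> U"
      unfolding W_def U_def using tube_path[OF q(3) r d] by blast
  qed
  have "B q x \<inter> ?E \<subseteq> A \<inter> {\<omega> \<in> space M. lab k \<omega> = d}"
  proof
    fix \<omega> assume "\<omega> \<in> B q x \<inter> ?E"
    then have \<omega>: "\<omega> \<in> space M" "\<omega> \<in> A" and X: "X k \<omega> = x" and t: "\<tau> k \<omega> < q" "q \<le> \<tau> (Suc k) \<omega>"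
      and W': "\<And>s. s \<in> {q..T} \<Longrightarrow> S s \<omega> \<in> W" and U': "S T \<omega> \<in> U"
      unfolding path_event_tube[OF q(2) qT(2)] by (auto simp: B_def before_def)
    have "lab k \<omega> = d"
    proof (cases "\<tau> (Suc k) \<omega> < T")
      case True
      obtain i where i: "\<bar>S (\<tau> (Suc k) \<omega>) \<omega> $ i - x $ i\<bar> = r"
        using S_\<tau>_Suc_boundary[OF \<omega>(1) True] X r_def by auto
      have "S (\<tau> (Suc k) \<omega>) \<omega> \<in> W" using W' t True by auto
      moreover have "S (\<tau> (Suc k) \<omega>) \<omega> \<notin> ocube x r" using i by (auto simp: ocube_def)
      ultimately have c: "S (\<tau> (Suc k) \<omega>) \<omega> \<in> ocube (x + r *\<^sub>R d) (r/2)" by (auto simp: W_def)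
      have "round_vec ((S (\<tau> (Suc k) \<omega>) \<omega> - x) /\<^sub>R r) = d"
      proof (rule round_vec_eqI[OF d])
        fix j
        have "((S (\<tau> (Suc k) \<omega>) \<omega> - x) /\<^sub>R r) $ j - d $ j
            = (S (\<tau> (Suc k) \<omega>) \<omega> $ j - (x $ j + r * d $ j)) / r"
          using r by (simp add: field_simps)
        moreover have "\<bar>S (\<tau> (Suc k) \<omega>) \<omega> $ j - (x $ j + r * d $ j)\<bar> < r / 2"
          using c by (simp add: ocube_def)
        ultimately show "\<bar>((S (\<tau> (Suc k) \<omega>) \<omega> - x) /\<^sub>R r) $ j - d $ j\<bar> < 1 / 2"
          by (simp only: abs_divide abs_of_pos[OF r] pos_divide_less_eq[OF r])
      qed
      then show ?thesis using True X by (simp add: lab_eq r_def)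
    next
      case False
      then have tT: "\<tau> (Suc k) \<omega> = T" using \<tau>_le_T[OF \<omega>(1), of "Suc k"] by simp
      have "S T \<omega> \<in> ccube x r"
        using S_between_ccube[OF \<omega>(1), of k T] t q tT X by (simp add: r_def)
      then have "d = 0" using U' by (auto simp: U_def split: if_splits)
      then show ?thesis using tT by (simp add: lab_eq)
    qed
    then show "\<omega> \<in> A \<inter> {\<omega> \<in> space M. lab k \<omega> = d}" using \<omega> by auto
  qed
  moreover have "A \<inter> {\<omega> \<in> space M. lab k \<omega> = d} \<in> sets M"
  proof -
    have "{\<omega> \<in> space M. lab k \<omega> = d} \<in> sets M"
      using measurable_sets[OF measurable_H_M[OF lab_meas_H], of "{d}" k]
      by (simp add: vimage_def Int_def conj_commute)
    then show ?thesis using AM by auto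
  qed
  ultimately have "emeasure M (B q x \<inter> ?E) \<le> emeasure M (A \<inter> {\<omega> \<in> space M. lab k \<omega> = d})"
    by (rule emeasure_mono)
  then show ?thesis using BE by auto
qed

section \<open>The density\<close>

text \<open>On the grid this is the equal mixture of the point mass at 0 and the uniform
  law.\<close>

definition weight :: "real ^ 'n \<Rightarrow> real" where
  "weight d = (if d = 0 then 1/2 else 0) + 1 / (2 * real (card (grid :: (real ^ 'n) set)))"

lemma card_grid_pos: "0 < card (grid :: (real ^ 'n) set)"
  using finite_grid zero_in_grid by (auto simp: card_gt_0_iff)

lemma grid_nonempty: "grid \<noteq> {}"
  using zero_in_grid by blast

lemma weight_pos: "0 < weight d"
  using card_grid_pos by (simp add: weight_def add_nonneg_pos)

lemma weight_0: "1/2 \<le> weight 0"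
  by (simp add: weight_def)

lemma sum_weight: "(\<Sum>d\<in>grid. weight d) = 1"
  using card_grid_pos by (simp add: weight_def sum.distrib finite_grid zero_in_grid grid_nonempty)

lemma sum_weight_nth: "(\<Sum>d\<in>grid. weight d * d $ i) = 0"
proof -
  have "bij_betw uminus grid (grid :: (real ^ 'n) set)"
    by (rule bij_betwI[where g=uminus]) (auto simp: uminus_in_grid_iff)
  from sum.reindex_bij_betw[OF this, of "\<lambda>d. weight d * d $ i"]
  have "(\<Sum>d\<in>grid. weight d * d $ i) = - (\<Sum>d\<in>grid. weight d * d $ i)"
    by (simp add: weight_def sum_negf)
  then show ?thesis by simp
qed

definition E :: "nat \<Rightarrow> real ^ 'n \<Rightarrow> 'a set" where
  "E k d = {\<omega> \<in> space M. lab k \<omega> = d}"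

definition p :: "nat \<Rightarrow> real ^ 'n \<Rightarrow> 'a \<Rightarrow> ennreal" where
  "p k d = nn_cond_exp M (H k) (indicator (E k d))"

text \<open>The likelihood ratio of one step: target weight over actual conditional probability of
  the observed displacement. A frozen walk makes no further choice, hence the factor 1. Values in
  \<open>ennreal\<close> allow products and integrals to be formed before any integrability is
  known.\<close>

definition Z :: "nat \<Rightarrow> 'a \<Rightarrow> ennreal" where
  "Z k \<omega> = (if \<omega> \<in> before k T then \<Sum>d\<in>grid. ennreal (weight d) / p k d \<omega> * indicator (E k d) \<omega> else 1)"

primrec L :: "nat \<Rightarrow> 'a \<Rightarrow> ennreal" where
  "L 0 \<omega> = 1"
| "L (Suc k) \<omega> = L k \<omega> * Z k \<omega>"

lemma E_sets_H: "E k d \<in> sets (H (Suc k))"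
  unfolding E_def using measurable_sets[OF lab_meas_H, of "{d}" k]
  by (simp add: space_H vimage_def Int_def conj_commute)

lemma sets_H_M: "A \<in> sets (H k) \<Longrightarrow> A \<in> sets M"
  using subalg_H by (auto simp: subalgebra_def)

lemma E_sets_M [measurable]: "E k d \<in> sets M"
  using E_sets_H sets_H_M by blast

lemma before_T_sets_M [measurable]: "before k T \<in> sets M"
  using before_T_sets_H sets_H_M by blast

lemma p_meas_H: "p k d \<in> borel_measurable (H k)"
  unfolding p_def by simp

lemma Z_meas_H: "Z k \<in> borel_measurable (H (Suc k))"
proof -
  note [measurable] = measurable_H_mono[OF le_SucI[OF order_refl] p_meas_H] E_sets_H
  have [measurable]: "before k T \<in> sets (H (Suc k))"
    using before_T_sets_H sets_H_mono[of k "Suc k"] by auto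
  show ?thesis unfolding Z_def[abs_def] by measurable
qed

lemma L_meas_H: "L k \<in> borel_measurable (H k)"
proof (induction k)
  case (Suc k)
  note [measurable] = measurable_H_mono[OF le_SucI[OF order_refl] Suc] Z_meas_H
  have "(\<lambda>\<omega>. L k \<omega> * Z k \<omega>) \<in> borel_measurable (H (Suc k))" by measurable
  then show ?case by simp
qed (simp add: measurable_const)

lemma sigma_finite_subalgebra_H: "sigma_finite_subalgebra M (H k)"
proof -
  interpret finite_measure_subalgebra M "H k" by unfold_locales (rule subalg_H)
  show ?thesis by unfold_locales
qed

text \<open>The zero set of the conditional probability is known at the exit time and meets the
  displacement event in a null set. By \<open>lab_reaches\<close> it is itself null.\<close>

lemma p_pos:
  assumes d: "d \<in> grid"
  shows "AE \<omega> in M. \<omega> \<in> before k T \<longrightarrow> p k d \<omega> \<noteq> 0"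
proof -
  interpret Hk: sigma_finite_subalgebra M "H k" by (rule sigma_finite_subalgebra_H)
  note [measurable] = p_meas_H
  define A where "A = {\<omega> \<in> space (H k). p k d \<omega> = 0} \<inter> before k T"
  have A: "A \<in> sets (H k)" unfolding A_def by measurable
  then have AM: "A \<in> sets M" by (rule sets_H_M)
  have "emeasure M (A \<inter> E k d) = (\<integral>\<^sup>+\<omega>. indicator A \<omega> * indicator (E k d) \<omega> \<partial>M)"
    using AM by (simp flip: indicator_inter_arith)
  also have "\<dots> = (\<integral>\<^sup>+\<omega>. indicator A \<omega> * p k d \<omega> \<partial>M)"
    unfolding p_def using A by (intro Hk.nn_cond_exp_intg[symmetric]) auto
  also have "\<dots> = (\<integral>\<^sup>+\<omega>. 0 \<partial>M)"
    by (intro nn_integral_cong) (auto simp: A_def indicator_def)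
  finally have "emeasure M (A \<inter> E k d) = 0" by simp
  then have "emeasure M A = 0"
    using lab_reaches[OF d A] unfolding A_def E_def by blast
  then have "A \<in> null_sets M" using AM by auto
  then show ?thesis
    by (rule AE_I') (auto simp: A_def space_H before_def)
qed

lemma p_finite: "AE \<omega> in M. p k d \<omega> \<noteq> \<infinity>"
proof -
  interpret Hk: sigma_finite_subalgebra M "H k" by (rule sigma_finite_subalgebra_H)
  have "(\<integral>\<^sup>+\<omega>. 1 * p k d \<omega> \<partial>M) = (\<integral>\<^sup>+\<omega>. 1 * indicator (E k d) \<omega> \<partial>M)"
    unfolding p_def by (intro Hk.nn_cond_exp_intg) auto
  also have "\<dots> = emeasure M (E k d)" by simp
  also have "\<dots> \<noteq> \<infinity>" by simp
  finally show ?thesis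
    using measurable_H_M[OF p_meas_H] by (intro nn_integral_PInf_AE) auto
qed

lemma Z_on_E:
  assumes "\<omega> \<in> before k T" "\<omega> \<in> E k d" "d \<in> grid"
  shows "Z k \<omega> = ennreal (weight d) / p k d \<omega>"
proof -
  have "(\<Sum>d'\<in>grid. ennreal (weight d') / p k d' \<omega> * indicator (E k d') \<omega>)
    = (\<Sum>d'\<in>grid. if d' = d then ennreal (weight d) / p k d \<omega> else 0)"
    using assms(2) by (intro sum.cong) (auto simp: E_def)
  then show ?thesis using assms by (simp add: Z_def finite_grid)
qed

text \<open>Everything except the indicator of \<open>E k d\<close> is known at the exit time, so
  this indicator may be replaced by its conditional probability, which cancels the denominator in
  \<open>Z\<close>.\<close>

lemma nn_integral_Z:
  assumes f: "f \<in> borel_measurable (H k)" and d: "d \<in> grid"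
  shows "(\<integral>\<^sup>+\<omega>. f \<omega> * Z k \<omega> * indicator (E k d) \<omega> * indicator (before k T) \<omega> \<partial>M)
    = (\<integral>\<^sup>+\<omega>. f \<omega> * ennreal (weight d) * indicator (before k T) \<omega> \<partial>M)"
proof -
  interpret Hk: sigma_finite_subalgebra M "H k" by (rule sigma_finite_subalgebra_H)
  let ?g = "\<lambda>\<omega>. f \<omega> * (ennreal (weight d) / p k d \<omega>) * indicator (before k T) \<omega>"
  note [measurable] = f p_meas_H
  have "(\<integral>\<^sup>+\<omega>. f \<omega> * Z k \<omega> * indicator (E k d) \<omega> * indicator (before k T) \<omega> \<partial>M)
    = (\<integral>\<^sup>+\<omega>. ?g \<omega> * indicator (E k d) \<omega> \<partial>M)"
    using Z_on_E[OF _ _ d] by (intro nn_integral_cong) (auto simp: indicator_def)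
  also have "\<dots> = (\<integral>\<^sup>+\<omega>. ?g \<omega> * p k d \<omega> \<partial>M)"
    unfolding p_def[of k d]
    by (intro Hk.nn_cond_exp_intg[symmetric]) measurable
  also have "\<dots> = (\<integral>\<^sup>+\<omega>. f \<omega> * ennreal (weight d) * indicator (before k T) \<omega> \<partial>M)"
  proof (rule nn_integral_cong_AE)
    show "AE \<omega> in M. ?g \<omega> * p k d \<omega> = f \<omega> * ennreal (weight d) * indicator (before k T) \<omega>"
      using p_pos[OF d, of k] p_finite[of k d]
    proof eventually_elim
      case (elim \<omega>)
      show ?case
      proof (cases "\<omega> \<in> before k T")
        case True
        then have "ennreal (weight d) / p k d \<omega> * p k d \<omega> = ennreal (weight d)"
          using elim by (simp add: ennreal_divide_times ennreal_divide_self less_top)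
        then show ?thesis using True by (simp add: mult.assoc)
      qed simp
    qed
  qed
  finally show ?thesis .
qed

text \<open>The density \<open>(a, b) = (1, 0)\<close> and the prices \<open>(a, b) = (0, 1)\<close> are treated at once.\<close>

definition \<phi> :: "real \<Rightarrow> real \<Rightarrow> 'n \<Rightarrow> real ^ 'n \<Rightarrow> real" where
  "\<phi> a b i x = a + b * x $ i"

lemma \<phi>_nonneg: "0 \<le> a \<Longrightarrow> 0 \<le> b \<Longrightarrow> x \<in> Ob \<Longrightarrow> 0 \<le> \<phi> a b i x"
  using Ob_pos[of x i] by (simp add: \<phi>_def less_imp_le)

lemma \<phi>_meas [measurable]: "\<phi> a b i \<in> borel_measurable borel"
  unfolding \<phi>_def[abs_def] by measurable

lemma grid_step_in:
  assumes "x \<in> Ob" "d \<in> grid"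
  shows "x + rad x *\<^sub>R d \<in> Ob"
proof -
  have r: "0 < rad x" by (rule rad_pos[OF assms(1)])
  have "x + rad x *\<^sub>R d \<in> ccube x (rad x)"
    using abs_grid_le[OF assms(2)] r by (simp add: ccube_def abs_mult mult_le_cancel_left1)
  then have "x + rad x *\<^sub>R d \<in> ccube x (2 * rad x)" using ccube_mono[of "rad x" "2 * rad x" x] r by auto
  then show ?thesis using ccube_subset[OF assms(1)] by blast
qed

lemma sum_weight_\<phi>: "(\<Sum>d\<in>grid. weight d * \<phi> a b i (x + r *\<^sub>R d)) = \<phi> a b i x"
proof -
  have "(\<Sum>d\<in>grid. weight d * \<phi> a b i (x + r *\<^sub>R d))
    = (\<Sum>d\<in>grid. \<phi> a b i x * weight d + b * r * (weight d * d $ i))"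
    by (intro sum.cong) (auto simp: \<phi>_def algebra_simps)
  also have "\<dots> = \<phi> a b i x * (\<Sum>d\<in>grid. weight d) + b * r * (\<Sum>d\<in>grid. weight d * d $ i)"
    by (simp only: sum.distrib sum_distrib_left)
  finally show ?thesis by (simp add: sum_weight sum_weight_nth)
qed

text \<open>One step of the reweighted walk averages over the weights. The set \<open>D\<close> is
  kept general for two uses: the whole grid gives the martingale property, the grid without 0 gives
  the part that has not frozen.\<close>

lemma nn_integral_step:
  assumes ab: "0 \<le> a" "0 \<le> b" and A: "A \<in> sets (H k)" and D: "D \<subseteq> grid"
  shows "(\<integral>\<^sup>+\<omega>. L (Suc k) \<omega> * ennreal (\<phi> a b i (X (Suc k) \<omega>)) * indicator A \<omega>
      * (indicator (before k T) \<omega> * indicator {\<omega>. lab k \<omega> \<in> D} \<omega>) \<partial>M)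
    = (\<integral>\<^sup>+\<omega>. L k \<omega> * ennreal (\<Sum>d\<in>D. weight d * \<phi> a b i (X k \<omega> + rad (X k \<omega>) *\<^sub>R d)) * indicator A \<omega>
      * indicator (before k T) \<omega> \<partial>M)"
proof -
  have fin: "finite D" using D finite_grid finite_subset by blast
  define f where "f d \<omega> = L k \<omega> * ennreal (\<phi> a b i (X k \<omega> + rad (X k \<omega>) *\<^sub>R d)) * indicator A \<omega>" for d \<omega>
  have f [measurable]: "f d \<in> borel_measurable (H k)" for d
    unfolding f_def[abs_def] using A L_meas_H[of k] by measurable
  have fM: "f d \<in> borel_measurable M" for d using measurable_H_M[OF f] .
  have ZM: "Z k \<in> borel_measurable M" using measurable_H_M[OF Z_meas_H] .
  note [measurable] = fM ZM
  have "(\<integral>\<^sup>+\<omega>. L (Suc k) \<omega> * ennreal (\<phi> a b i (X (Suc k) \<omega>)) * indicator A \<omega>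
      * (indicator (before k T) \<omega> * indicator {\<omega>. lab k \<omega> \<in> D} \<omega>) \<partial>M)
    = (\<integral>\<^sup>+\<omega>. (\<Sum>d\<in>D. f d \<omega> * Z k \<omega> * indicator (E k d) \<omega> * indicator (before k T) \<omega>) \<partial>M)"
  proof (rule nn_integral_cong)
    fix \<omega> assume \<omega>: "\<omega> \<in> space M"
    have "(\<Sum>d\<in>D. f d \<omega> * Z k \<omega> * indicator (E k d) \<omega> * indicator (before k T) \<omega>)
      = (\<Sum>d\<in>D. if d = lab k \<omega> then f (lab k \<omega>) \<omega> * Z k \<omega> * indicator (before k T) \<omega> else 0)"
      using \<omega> by (intro sum.cong) (auto simp: E_def)
    also have "\<dots> = f (lab k \<omega>) \<omega> * Z k \<omega> * indicator (before k T) \<omega> * indicator {\<omega>. lab k \<omega> \<in> D} \<omega>"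
      using fin by (simp add: indicator_def)
    finally show "L (Suc k) \<omega> * ennreal (\<phi> a b i (X (Suc k) \<omega>)) * indicator A \<omega>
      * (indicator (before k T) \<omega> * indicator {\<omega>. lab k \<omega> \<in> D} \<omega>)
      = (\<Sum>d\<in>D. f d \<omega> * Z k \<omega> * indicator (E k d) \<omega> * indicator (before k T) \<omega>)"
      by (simp add: f_def X_Suc ac_simps)
  qed
  also have "\<dots> = (\<Sum>d\<in>D. \<integral>\<^sup>+\<omega>. f d \<omega> * Z k \<omega> * indicator (E k d) \<omega> * indicator (before k T) \<omega> \<partial>M)"
    by (rule nn_integral_sum) measurable
  also have "\<dots> = (\<Sum>d\<in>D. \<integral>\<^sup>+\<omega>. f d \<omega> * ennreal (weight d) * indicator (before k T) \<omega> \<partial>M)"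
    using D by (intro sum.cong nn_integral_Z f) auto
  also have "\<dots> = (\<integral>\<^sup>+\<omega>. (\<Sum>d\<in>D. f d \<omega> * ennreal (weight d) * indicator (before k T) \<omega>) \<partial>M)"
    by (rule nn_integral_sum[symmetric]) measurable
  also have "\<dots> = (\<integral>\<^sup>+\<omega>. L k \<omega> * ennreal (\<Sum>d\<in>D. weight d * \<phi> a b i (X k \<omega> + rad (X k \<omega>) *\<^sub>R d)) * indicator A \<omega>
      * indicator (before k T) \<omega> \<partial>M)"
  proof (rule nn_integral_cong)
    fix \<omega> assume \<omega>: "\<omega> \<in> space M"
    have nn: "0 \<le> \<phi> a b i (X k \<omega> + rad (X k \<omega>) *\<^sub>R d)" if "d \<in> D" for d
      using that D by (intro \<phi>_nonneg ab grid_step_in X_in \<omega>) auto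
    have "ennreal (\<Sum>d\<in>D. weight d * \<phi> a b i (X k \<omega> + rad (X k \<omega>) *\<^sub>R d))
      = (\<Sum>d\<in>D. ennreal (weight d * \<phi> a b i (X k \<omega> + rad (X k \<omega>) *\<^sub>R d)))"
      by (rule sum_ennreal[symmetric]) (simp add: nn weight_pos less_imp_le)
    also have "\<dots> = (\<Sum>d\<in>D. ennreal (weight d) * ennreal (\<phi> a b i (X k \<omega> + rad (X k \<omega>) *\<^sub>R d)))"
      by (intro sum.cong ennreal_mult nn refl less_imp_le[OF weight_pos])
    finally show "(\<Sum>d\<in>D. f d \<omega> * ennreal (weight d) * indicator (before k T) \<omega>)
      = L k \<omega> * ennreal (\<Sum>d\<in>D. weight d * \<phi> a b i (X k \<omega> + rad (X k \<omega>) *\<^sub>R d)) * indicator A \<omega>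
      * indicator (before k T) \<omega>"
      by (simp add: f_def sum_distrib_left sum_distrib_right ac_simps)
  qed
  finally show ?thesis .
qed

text \<open>With \<open>a = 1\<close> and \<open>b = 0\<close> this is the mass of \<open>A\<close>
  under the density \<open>L k\<close>; with \<open>a = 0\<close> and \<open>b = 1\<close> it is the
  integral of coordinate \<open>i\<close> of the centre over \<open>A\<close> under that
  density.\<close>

definition J :: "real \<Rightarrow> real \<Rightarrow> 'n \<Rightarrow> nat \<Rightarrow> 'a set \<Rightarrow> ennreal" where
  "J a b i k A = (\<integral>\<^sup>+\<omega>. L k \<omega> * ennreal (\<phi> a b i (X k \<omega>)) * indicator A \<omega> \<partial>M)"

lemma L_meas_M [measurable]: "L k \<in> borel_measurable M"
  and X_meas_M [measurable]: "X k \<in> borel_measurable M"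
  using measurable_H_M[OF L_meas_H] measurable_H_M[OF X_meas_H] by auto

lemma stationary_step:
  assumes "\<omega> \<in> space M" "\<omega> \<notin> before k T"
  shows "L (Suc k) \<omega> = L k \<omega>" "X (Suc k) \<omega> = X k \<omega>" "\<tau> k \<omega> = T"
proof -
  show t: "\<tau> k \<omega> = T" using assms \<tau>_le_T[OF assms(1), of k] by (auto simp: before_def)
  show "L (Suc k) \<omega> = L k \<omega>" using assms(2) by (simp add: Z_def)
  show "X (Suc k) \<omega> = X k \<omega>" using \<tau>_X_stationary(2)[OF assms(1) t, of "Suc k"] by simp
qed

lemma J_Suc:
  assumes ab: "0 \<le> a" "0 \<le> b" and A: "A \<in> sets (H k)"
  shows "J a b i (Suc k) A = J a b i k A"
proof -
  have [measurable]: "A \<in> sets M" using sets_H_M[OF A] .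
  let ?s = "\<lambda>\<omega>. indicator (space M - before k T) \<omega>" and ?b = "\<lambda>\<omega>. indicator (before k T) \<omega>"
  let ?g = "\<lambda>k \<omega>. L k \<omega> * ennreal (\<phi> a b i (X k \<omega>)) * indicator A \<omega>"
  have split: "J a b i j A = (\<integral>\<^sup>+\<omega>. ?g j \<omega> * ?s \<omega> \<partial>M) + (\<integral>\<^sup>+\<omega>. ?g j \<omega> * ?b \<omega> \<partial>M)" for j
    unfolding J_def
    by (subst nn_integral_add[symmetric])
       (auto intro!: nn_integral_cong simp: indicator_def)
  have "(\<integral>\<^sup>+\<omega>. ?g (Suc k) \<omega> * ?s \<omega> \<partial>M) = (\<integral>\<^sup>+\<omega>. ?g k \<omega> * ?s \<omega> \<partial>M)"
  proof (rule nn_integral_cong)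
    fix \<omega> assume "\<omega> \<in> space M"
    then show "?g (Suc k) \<omega> * ?s \<omega> = ?g k \<omega> * ?s \<omega>"
      using stationary_step[of \<omega> k] by (cases "\<omega> \<in> before k T") (auto simp del: L.simps)
  qed
  moreover have "(\<integral>\<^sup>+\<omega>. ?g (Suc k) \<omega> * ?b \<omega> \<partial>M) = (\<integral>\<^sup>+\<omega>. ?g k \<omega> * ?b \<omega> \<partial>M)"
  proof -
    have "(\<integral>\<^sup>+\<omega>. ?g (Suc k) \<omega> * ?b \<omega> \<partial>M) = (\<integral>\<^sup>+\<omega>. ?g (Suc k) \<omega> * (?b \<omega> * indicator {\<omega>. lab k \<omega> \<in> grid} \<omega>) \<partial>M)"
      using lab_in_grid by (intro nn_integral_cong) (auto simp: indicator_def)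
    also have "\<dots> = (\<integral>\<^sup>+\<omega>. L k \<omega> * ennreal (\<Sum>d\<in>grid. weight d * \<phi> a b i (X k \<omega> + rad (X k \<omega>) *\<^sub>R d)) * indicator A \<omega> * ?b \<omega> \<partial>M)"
      by (rule nn_integral_step[OF ab A order_refl])
    finally show ?thesis by (simp only: sum_weight_\<phi>)
  qed
  ultimately show ?thesis using split[of k] split[of "Suc k"] by simp
qed

lemma J_eq:
  assumes ab: "0 \<le> a" "0 \<le> b" and A: "A \<in> sets (H m)" and "m \<le> j"
  shows "J a b i j A = J a b i m A"
  using \<open>m \<le> j\<close>
proof (induction rule: dec_induct)
  case (step n)
  then have "A \<in> sets (H n)" using A sets_H_mono by blast
  then show ?case using J_Suc[OF ab] step by simp
qed simp

definition N :: "real \<Rightarrow> real \<Rightarrow> 'n \<Rightarrow> nat \<Rightarrow> ennreal" where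
  "N a b i k = (\<integral>\<^sup>+\<omega>. L k \<omega> * ennreal (\<phi> a b i (X k \<omega>)) * indicator (before k T) \<omega> \<partial>M)"

text \<open>Remaining unfrozen means a nonzero displacement. The term with displacement 0 leaves the
  centre unchanged and carries at least half of the average, so at most half remains. This applies
  to the prices as well as to the mass, which later excludes a loss of either in the limit.\<close>

lemma N_Suc:
  assumes ab: "0 \<le> a" "0 \<le> b"
  shows "N a b i (Suc k) \<le> ennreal (1/2) * N a b i k"
proof -
  let ?D = "grid - {0} :: (real ^ 'n) set"
  have "N a b i (Suc k) = (\<integral>\<^sup>+\<omega>. L (Suc k) \<omega> * ennreal (\<phi> a b i (X (Suc k) \<omega>)) * indicator (space M) \<omega>
      * (indicator (before k T) \<omega> * indicator {\<omega>. lab k \<omega> \<in> ?D} \<omega>) \<partial>M)"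
    unfolding N_def
  proof (rule nn_integral_cong)
    fix \<omega> assume \<omega>: "\<omega> \<in> space M"
    have "\<omega> \<in> before (Suc k) T \<longleftrightarrow> \<omega> \<in> before k T \<and> lab k \<omega> \<in> ?D"
      using \<omega> lab_in_grid[OF \<omega>, of k] lab_eq_0_iff[OF \<omega>, of k] \<tau>_Suc_ge[OF \<omega>, of k] \<tau>_le_T[OF \<omega>, of "Suc k"]
      by (auto simp: before_def)
    then show "L (Suc k) \<omega> * ennreal (\<phi> a b i (X (Suc k) \<omega>)) * indicator (before (Suc k) T) \<omega> =
        L (Suc k) \<omega> * ennreal (\<phi> a b i (X (Suc k) \<omega>)) * indicator (space M) \<omega>
        * (indicator (before k T) \<omega> * indicator {\<omega>. lab k \<omega> \<in> ?D} \<omega>)"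
      using \<omega> by (auto simp: indicator_def simp del: L.simps)
  qed
  also have "\<dots> = (\<integral>\<^sup>+\<omega>. L k \<omega> * ennreal (\<Sum>d\<in>?D. weight d * \<phi> a b i (X k \<omega> + rad (X k \<omega>) *\<^sub>R d))
      * indicator (space M) \<omega> * indicator (before k T) \<omega> \<partial>M)"
    using sets.top[of "H k"] by (intro nn_integral_step[OF ab]) (auto simp: space_H)
  also have "\<dots> \<le> (\<integral>\<^sup>+\<omega>. ennreal (1/2) * (L k \<omega> * ennreal (\<phi> a b i (X k \<omega>)) * indicator (before k T) \<omega>) \<partial>M)"
  proof (rule nn_integral_mono)
    fix \<omega> assume \<omega>: "\<omega> \<in> space M"
    let ?x = "X k \<omega>"
    have "(\<Sum>d\<in>?D. weight d * \<phi> a b i (?x + rad ?x *\<^sub>R d)) = \<phi> a b i ?x - weight 0 * \<phi> a b i ?x"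
      using sum_weight_\<phi>[of a b i ?x "rad ?x"]
      by (simp add: sum_diff1 finite_grid zero_in_grid)
    also have "\<dots> \<le> 1/2 * \<phi> a b i ?x"
      using mult_right_mono[OF weight_0 \<phi>_nonneg[OF ab X_in[OF \<omega>, of k], of i]] by simp
    finally have "ennreal (\<Sum>d\<in>?D. weight d * \<phi> a b i (?x + rad ?x *\<^sub>R d)) \<le> ennreal (1/2) * ennreal (\<phi> a b i ?x)"
      using \<phi>_nonneg[OF ab X_in[OF \<omega>, of k], of i]
      by (subst ennreal_mult[symmetric]) (auto intro: ennreal_leI)
    then have "L k \<omega> * ennreal (\<Sum>d\<in>?D. weight d * \<phi> a b i (?x + rad ?x *\<^sub>R d)) * indicator (before k T) \<omega>
      \<le> L k \<omega> * (ennreal (1/2) * ennreal (\<phi> a b i ?x)) * indicator (before k T) \<omega>"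
      by (intro mult_left_mono mult_right_mono) auto
    then show "L k \<omega> * ennreal (\<Sum>d\<in>?D. weight d * \<phi> a b i (?x + rad ?x *\<^sub>R d)) * indicator (space M) \<omega> * indicator (before k T) \<omega>
      \<le> ennreal (1/2) * (L k \<omega> * ennreal (\<phi> a b i ?x) * indicator (before k T) \<omega>)"
      using \<omega> by (simp add: ac_simps)
  qed
  also have "\<dots> = ennreal (1/2) * N a b i k"
    unfolding N_def by (rule nn_integral_cmult) measurable
  finally show ?thesis .
qed

lemma N_0_finite:
  assumes ab: "0 \<le> a" "0 \<le> b"
  shows "N a b i 0 < \<infinity>"
proof -
  have [measurable]: "X0 \<in> borel_measurable M"
    using X_meas_M[of 0] by (simp add: X_0[abs_def] cong: measurable_cong)
  have "N a b i 0 \<le> (\<integral>\<^sup>+\<omega>. ennreal a + ennreal b * ennreal (X0 \<omega> $ i) \<partial>M)"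
    unfolding N_def
  proof (rule nn_integral_mono)
    fix \<omega> assume \<omega>: "\<omega> \<in> space M"
    have "0 \<le> X0 \<omega> $ i" using Ob_pos[OF X0_in[OF \<omega>], of i] by simp
    then have "ennreal (\<phi> a b i (X 0 \<omega>)) = ennreal a + ennreal b * ennreal (X0 \<omega> $ i)"
      using ab by (simp add: \<phi>_def ennreal_mult)
    then show "L 0 \<omega> * ennreal (\<phi> a b i (X 0 \<omega>)) * indicator (before 0 T) \<omega>
      \<le> ennreal a + ennreal b * ennreal (X0 \<omega> $ i)"
      by (simp add: indicator_def)
  qed
  also have "\<dots> = ennreal a + ennreal b * (\<integral>\<^sup>+\<omega>. ennreal (X0 \<omega> $ i) \<partial>M)"
    by (simp add: nn_integral_add nn_integral_cmult emeasure_space_1)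
  also have "\<dots> < \<infinity>" using X0_integrable[of i] by (simp add: ennreal_mult_less_top)
  finally show ?thesis .
qed

lemma N_tendsto_0:
  assumes ab: "0 \<le> a" "0 \<le> b"
  shows "N a b i \<longlonglongrightarrow> 0"
proof -
  obtain r where r: "r \<ge> 0" "N a b i 0 = ennreal r"
    using N_0_finite[OF ab, of i] by (cases "N a b i 0") auto
  have le: "N a b i k \<le> ennreal ((1/2)^k * r)" for k
  proof (induction k)
    case (Suc k)
    have "N a b i (Suc k) \<le> ennreal (1/2) * N a b i k" by (rule N_Suc[OF ab])
    also have "\<dots> \<le> ennreal (1/2) * ennreal ((1/2)^k * r)" by (intro mult_left_mono Suc) simp
    also have "\<dots> = ennreal ((1/2)^Suc k * r)"
      using r ennreal_mult[of "1/2" "(1/2)^k * r"] by (simp add: mult.assoc)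
    finally show ?case .
  qed (simp add: r)
  have "(\<lambda>k. ennreal ((1/2)^k * r)) \<longlonglongrightarrow> ennreal (0 * r)"
    by (intro tendsto_ennrealI tendsto_intros LIMSEQ_power_zero) auto
  then have lim: "(\<lambda>k. ennreal ((1/2)^k * r)) \<longlonglongrightarrow> 0" by simp
  show ?thesis
    by (rule tendsto_sandwich[OF always_eventually always_eventually tendsto_const lim]) (simp_all add: le)
qed

definition K :: "'a \<Rightarrow> nat" where "K \<omega> = (LEAST k. \<omega> \<notin> before k T)"
definition L_inf :: "'a \<Rightarrow> ennreal" where "L_inf \<omega> = L (K \<omega>) \<omega>"
definition X_inf :: "'a \<Rightarrow> real ^ 'n" where "X_inf \<omega> = X (K \<omega>) \<omega>"

lemma K_meas [measurable]: "K \<in> measurable M (count_space UNIV)"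
  unfolding K_def[abs_def] by measurable

lemma L_inf_meas [measurable]: "L_inf \<in> borel_measurable M"
  unfolding L_inf_def[abs_def] by (rule measurable_compose_countable) measurable

lemma X_inf_meas [measurable]: "X_inf \<in> borel_measurable M"
  unfolding X_inf_def[abs_def] by (rule measurable_compose_countable) measurable

lemma not_before_K:
  assumes "\<omega> \<in> space M"
  shows "\<omega> \<notin> before (K \<omega>) T"
proof -
  obtain k where "\<tau> k \<omega> = T" using \<tau>_eventually_T[OF assms] .
  then have "\<omega> \<notin> before k T" by (simp add: before_def)
  then show ?thesis unfolding K_def by (rule LeastI)
qed

lemma K_le: "\<omega> \<notin> before k T \<Longrightarrow> K \<omega> \<le> k"
  unfolding K_def by (rule Least_le)

lemma not_before_mono:
  assumes "\<omega> \<in> space M" "\<omega> \<notin> before k T" "k \<le> j"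
  shows "\<omega> \<notin> before j T"
  using assms \<tau>_mono[OF assms(1,3)] by (auto simp: before_def)

lemma stationary_after_K:
  assumes \<omega>: "\<omega> \<in> space M" and "K \<omega> \<le> k"
  shows "L k \<omega> = L_inf \<omega>" "X k \<omega> = X_inf \<omega>"
proof -
  from assms(2) have "L k \<omega> = L_inf \<omega> \<and> X k \<omega> = X_inf \<omega>"
  proof (induction rule: dec_induct)
    case (step n)
    then have "\<omega> \<notin> before n T" using not_before_mono[OF \<omega> not_before_K[OF \<omega>]] by simp
    then show ?case using stationary_step[OF \<omega>] step by metis
  qed (simp add: L_inf_def X_inf_def)
  then show "L k \<omega> = L_inf \<omega>" "X k \<omega> = X_inf \<omega>" by auto
qed

lemma nn_integral_L_inf:
  assumes ab: "0 \<le> a" "0 \<le> b" and A: "A \<in> sets (H m)"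
  shows "(\<integral>\<^sup>+\<omega>. L_inf \<omega> * ennreal (\<phi> a b i (X_inf \<omega>)) * indicator A \<omega> \<partial>M) = J a b i m A"
proof -
  have [measurable]: "A \<in> sets M" using sets_H_M[OF A] .
  let ?g = "\<lambda>\<omega>. L_inf \<omega> * ennreal (\<phi> a b i (X_inf \<omega>)) * indicator A \<omega>"
  define c where "c j = (\<integral>\<^sup>+\<omega>. ?g \<omega> * indicator (space M - before j T) \<omega> \<partial>M)" for j
  define n where "n j = (\<integral>\<^sup>+\<omega>. L j \<omega> * ennreal (\<phi> a b i (X j \<omega>)) * indicator A \<omega> * indicator (before j T) \<omega> \<partial>M)" for j
  have "c \<longlonglongrightarrow> (\<integral>\<^sup>+\<omega>. ?g \<omega> \<partial>M)"
    unfolding c_def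
  proof (rule nn_integral_LIMSEQ)
    show "incseq (\<lambda>j \<omega>. ?g \<omega> * indicator (space M - before j T) \<omega>)"
    proof (intro incseq_SucI le_funI mult_left_mono)
      fix j \<omega>
      show "indicator (space M - before j T) \<omega> \<le> (indicator (space M - before (Suc j) T) \<omega> :: ennreal)"
        using not_before_mono[of \<omega> j "Suc j"] by (auto simp: indicator_def)
    qed simp
    show "(\<lambda>\<omega>. ?g \<omega> * indicator (space M - before j T) \<omega>) \<in> borel_measurable M" for j by measurable
    fix \<omega>
    have "eventually (\<lambda>j. ?g \<omega> * indicator (space M - before j T) \<omega> = ?g \<omega>) sequentially"
    proof (cases "\<omega> \<in> space M")
      case \<omega>: True
      show ?thesis
        using not_before_mono[OF \<omega> not_before_K[OF \<omega>]] \<omega>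
        by (intro eventually_sequentiallyI[of "K \<omega>"]) auto
    next
      case False
      then have "\<omega> \<notin> A" using sets.sets_into_space[OF \<open>A \<in> sets M\<close>] by auto
      then show ?thesis by simp
    qed
    then show "(\<lambda>j. ?g \<omega> * indicator (space M - before j T) \<omega>) \<longlonglongrightarrow> ?g \<omega>"
      by (rule tendsto_eventually)
  qed
  moreover have "n \<longlonglongrightarrow> 0"
  proof (rule tendsto_sandwich[OF _ _ tendsto_const N_tendsto_0[OF ab, of i]])
    show "\<forall>\<^sub>F j in sequentially. n j \<le> N a b i j"
      unfolding n_def N_def
      by (intro always_eventually allI nn_integral_mono) (auto simp: indicator_def)
  qed simp
  ultimately have "(\<lambda>j. c j + n j) \<longlonglongrightarrow> (\<integral>\<^sup>+\<omega>. ?g \<omega> \<partial>M) + 0" by (intro tendsto_add)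
  then have lim: "(\<lambda>j. c j + n j) \<longlonglongrightarrow> (\<integral>\<^sup>+\<omega>. ?g \<omega> \<partial>M)" by simp
  have cn: "c j + n j = J a b i j A" for j
    unfolding c_def n_def J_def
  proof (subst nn_integral_add[symmetric])
    show "(\<integral>\<^sup>+\<omega>. ?g \<omega> * indicator (space M - before j T) \<omega>
        + L j \<omega> * ennreal (\<phi> a b i (X j \<omega>)) * indicator A \<omega> * indicator (before j T) \<omega> \<partial>M)
      = (\<integral>\<^sup>+\<omega>. L j \<omega> * ennreal (\<phi> a b i (X j \<omega>)) * indicator A \<omega> \<partial>M)"
    proof (rule nn_integral_cong)
      fix \<omega> assume \<omega>: "\<omega> \<in> space M"
      show "?g \<omega> * indicator (space M - before j T) \<omega>
        + L j \<omega> * ennreal (\<phi> a b i (X j \<omega>)) * indicator A \<omega> * indicator (before j T) \<omega>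
        = L j \<omega> * ennreal (\<phi> a b i (X j \<omega>)) * indicator A \<omega>"
      proof (cases "\<omega> \<in> before j T")
        case False
        then show ?thesis using stationary_after_K[OF \<omega> K_le[OF False]] \<omega> by simp
      qed simp
    qed
  qed measurable
  have "c j + n j = J a b i m A" if "m \<le> j" for j
    using cn[of j] J_eq[OF ab A that] by (rule trans)
  then have "eventually (\<lambda>j. c j + n j = J a b i m A) sequentially"
    by (rule eventually_sequentiallyI)
  then have "(\<lambda>j. c j + n j) \<longlonglongrightarrow> J a b i m A" by (rule tendsto_eventually)
  then show ?thesis using lim LIMSEQ_unique by blast
qed

text \<open>For each path the density is a finite product, and each factor is a positive weight over
  a conditional probability that is finite almost everywhere.\<close>

lemma L_inf_pos: "AE \<omega> in M. L_inf \<omega> \<noteq> 0"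
proof -
  have "AE \<omega> in M. \<forall>k. \<forall>d\<in>grid. p k d \<omega> \<noteq> \<infinity>"
    unfolding AE_all_countable by (intro allI AE_finite_allI finite_grid p_finite)
  moreover have "AE \<omega> in M. \<omega> \<in> space M" by (rule AE_space)
  ultimately show ?thesis
  proof eventually_elim
    case (elim \<omega>)
    have "L k \<omega> \<noteq> 0" for k
    proof (induction k)
      case (Suc k)
      have "Z k \<omega> \<noteq> 0"
      proof (cases "\<omega> \<in> before k T")
        case True
        have g: "lab k \<omega> \<in> grid" using elim lab_in_grid by auto
        then have "Z k \<omega> = ennreal (weight (lab k \<omega>)) / p k (lab k \<omega>) \<omega>"
          using Z_on_E[OF True] elim by (auto simp: E_def)
        then show ?thesis using elim g weight_pos[of "lab k \<omega>"]
          by (auto simp: ennreal_divide_eq_0_iff)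
      qed (simp add: Z_def)
      then show ?case using Suc by simp
    qed simp
    then show ?case by (simp add: L_inf_def)
  qed
qed

section \<open>The price system\<close>

definition Q :: "'a measure" where "Q = density M L_inf"

lemma space_Q [simp]: "space Q = space M" and sets_Q [simp, measurable_cong]: "sets Q = sets M"
  by (simp_all add: Q_def)

lemma nn_integral_Q: "f \<in> borel_measurable M \<Longrightarrow> (\<integral>\<^sup>+\<omega>. f \<omega> \<partial>Q) = (\<integral>\<^sup>+\<omega>. L_inf \<omega> * f \<omega> \<partial>M)"
  unfolding Q_def by (rule nn_integral_density) measurable

lemma emeasure_Q_H:
  assumes A: "A \<in> sets (H m)"
  shows "emeasure Q A = J 1 0 i m A"
proof -
  have [measurable]: "A \<in> sets M" using sets_H_M[OF A] .
  have "emeasure Q A = (\<integral>\<^sup>+\<omega>. L_inf \<omega> * indicator A \<omega> \<partial>M)"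
    unfolding Q_def by (rule emeasure_density) measurable
  also have "\<dots> = (\<integral>\<^sup>+\<omega>. L_inf \<omega> * ennreal (\<phi> 1 0 i (X_inf \<omega>)) * indicator A \<omega> \<partial>M)"
    by (simp add: \<phi>_def)
  also have "\<dots> = J 1 0 i m A" by (rule nn_integral_L_inf[OF _ _ A]) auto
  finally show ?thesis .
qed

lemma nn_integral_X_inf_Q:
  assumes A: "A \<in> sets (H m)"
  shows "(\<integral>\<^sup>+\<omega>. ennreal (X_inf \<omega> $ i) * indicator A \<omega> \<partial>Q) = J 0 1 i m A"
proof -
  have [measurable]: "A \<in> sets M" using sets_H_M[OF A] .
  have "(\<integral>\<^sup>+\<omega>. ennreal (X_inf \<omega> $ i) * indicator A \<omega> \<partial>Q)
    = (\<integral>\<^sup>+\<omega>. L_inf \<omega> * ennreal (\<phi> 0 1 i (X_inf \<omega>)) * indicator A \<omega> \<partial>M)"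
    by (subst nn_integral_Q) (auto simp: \<phi>_def mult.assoc)
  also have "\<dots> = J 0 1 i m A" by (rule nn_integral_L_inf[OF _ _ A]) auto
  finally show ?thesis .
qed

lemma space_in_H: "space M \<in> sets (H k)"
  using sets.top[of "H k"] by (simp add: space_H)

lemma prob_space_Q: "prob_space Q"
proof
  have "emeasure Q (space M) = J 1 0 undefined 0 (space M)" by (rule emeasure_Q_H[OF space_in_H])
  also have "\<dots> = 1" by (simp add: J_def \<phi>_def emeasure_space_1)
  finally show "emeasure Q (space Q) = 1" by simp
qed

lemma AE_Q_iff: "(AE \<omega> in Q. P \<omega>) \<longleftrightarrow> (AE \<omega> in M. P \<omega>)"
proof -
  have "(AE \<omega> in Q. P \<omega>) \<longleftrightarrow> (AE \<omega> in M. 0 < L_inf \<omega> \<longrightarrow> P \<omega>)"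
    unfolding Q_def by (rule AE_density) measurable
  also have "\<dots> \<longleftrightarrow> (AE \<omega> in M. P \<omega>)"
  proof
    assume "AE \<omega> in M. 0 < L_inf \<omega> \<longrightarrow> P \<omega>"
    with L_inf_pos show "AE \<omega> in M. P \<omega>" by eventually_elim (simp add: zero_less_iff_neq_zero)
  qed auto
  finally show ?thesis .
qed

lemma equiv_prob_Q: "equiv_prob M Q"
proof -
  have "emeasure M A = 0 \<longleftrightarrow> emeasure Q A = 0" if A: "A \<in> sets M" for A
  proof -
    have "emeasure M A = 0 \<longleftrightarrow> (AE \<omega> in M. \<omega> \<notin> A)"
      by (rule AE_iff_measurable[OF A, symmetric]) (use sets.sets_into_space[OF A] in auto)
    also have "\<dots> \<longleftrightarrow> (AE \<omega> in Q. \<omega> \<notin> A)" by (rule AE_Q_iff[symmetric])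
    also have "\<dots> \<longleftrightarrow> emeasure Q A = 0"
      by (rule AE_iff_measurable) (use A sets.sets_into_space[OF A] in auto)
    finally show ?thesis .
  qed
  then show ?thesis using prob_space_Q by (simp add: equiv_prob_def)
qed

lemma X_inf_in: "\<omega> \<in> space M \<Longrightarrow> X_inf \<omega> \<in> Ob"
  unfolding X_inf_def by (rule X_in)

lemma X_inf_pos: "\<omega> \<in> space M \<Longrightarrow> 0 < X_inf \<omega> $ i"
  by (intro Ob_pos X_inf_in)

lemma integrable_X_inf: "integrable Q (\<lambda>\<omega>. X_inf \<omega> $ i)"
proof (rule integrableI_nonneg)
  have "(\<integral>\<^sup>+\<omega>. ennreal (X_inf \<omega> $ i) \<partial>Q) = (\<integral>\<^sup>+\<omega>. ennreal (X_inf \<omega> $ i) * indicator (space M) \<omega> \<partial>Q)"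
    by (intro nn_integral_cong) auto
  also have "\<dots> = J 0 1 i 0 (space M)" by (rule nn_integral_X_inf_Q[OF space_in_H])
  also have "\<dots> = (\<integral>\<^sup>+\<omega>. ennreal (X0 \<omega> $ i) \<partial>M)"
    unfolding J_def by (intro nn_integral_cong) (auto simp: \<phi>_def)
  also have "\<dots> < \<infinity>" by (rule X0_integrable)
  finally show "(\<integral>\<^sup>+\<omega>. ennreal (X_inf \<omega> $ i) \<partial>Q) < \<infinity>" .
  show "AE \<omega> in Q. 0 \<le> X_inf \<omega> $ i" using X_inf_pos by (intro AE_I2) (auto intro: less_imp_le)
qed measurable

text \<open>On \<open>A\<close> the time \<open>t\<close> lies after exit \<open>k\<close> and not
  after exit \<open>k + 1\<close>. So \<open>A\<close> is known at exit \<open>k + 1\<close>, though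
  it need not be at exit \<open>k\<close>, and the terminal centre may be replaced there by
  \<open>X (Suc k)\<close>. This neighbour of \<open>x\<close> differs from it by at most
  \<open>rad x\<close> in each coordinate.\<close>

lemma integral_X_inf_bounds:
  assumes t: "t \<in> {0..T}" and A: "A \<in> sets (F t)"
    and sub: "A \<subseteq> {\<omega> \<in> space M. X k \<omega> = x} \<inter> before k t - before (Suc k) t" and x: "x \<in> Ob"
  shows "(x $ i - rad x) * measure Q A \<le> (\<integral>\<omega>. indicator A \<omega> * X_inf \<omega> $ i \<partial>Q)"
    and "(\<integral>\<omega>. indicator A \<omega> * X_inf \<omega> $ i \<partial>Q) \<le> (x $ i + rad x) * measure Q A"
proof -
  interpret Q: prob_space Q by (rule prob_space_Q)
  let ?l = "x $ i - rad x" and ?u = "x $ i + rad x" and ?I = "\<integral>\<omega>. indicator A \<omega> * X_inf \<omega> $ i \<partial>Q"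
  have AH: "A \<in> sets (H (Suc k))" using sub by (intro F_sets_in_H[OF t A]) auto
  have AM [measurable]: "A \<in> sets M" using sets_F_M[OF t A] .
  have rx: "0 < rad x" by (rule rad_pos[OF x])
  \<comment> \<open>The lower corner of the cube belongs to \<open>Ob\<close>, so the lower bound is
    positive and survives the passage to \<open>ennreal\<close>.\<close>
  have "0 < (\<chi> j. x $ j - rad x) $ i"
    using ccube_subset[OF x] rx by (intro Ob_pos) (auto simp: ccube_def)
  then have l: "0 \<le> ?l" and u: "0 \<le> ?u" using rx by auto
  have int: "integrable Q (\<lambda>\<omega>. indicator A \<omega> * X_inf \<omega> $ i)"
    using integrable_real_mult_indicator[OF _ integrable_X_inf, of A] by (simp add: mult.commute)
  have nn: "AE \<omega> in Q. 0 \<le> indicator A \<omega> * X_inf \<omega> $ i"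
    using X_inf_pos by (intro AE_I2) (auto simp: indicator_def less_imp_le)
  have I: "ennreal ?I = J 0 1 i (Suc k) A"
  proof -
    have "ennreal ?I = (\<integral>\<^sup>+\<omega>. ennreal (indicator A \<omega> * X_inf \<omega> $ i) \<partial>Q)"
      by (rule nn_integral_eq_integral[OF int nn, symmetric])
    also have "\<dots> = (\<integral>\<^sup>+\<omega>. ennreal (X_inf \<omega> $ i) * indicator A \<omega> \<partial>Q)"
      by (intro nn_integral_cong) (auto simp: indicator_def)
    finally show ?thesis by (simp only: nn_integral_X_inf_Q[OF AH])
  qed
  have I_nn: "0 \<le> ?I" by (rule integral_nonneg_AE[OF nn])
  have bd: "?l \<le> X (Suc k) \<omega> $ i \<and> X (Suc k) \<omega> $ i \<le> ?u" if "\<omega> \<in> A" for \<omega>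
  proof -
    have "\<omega> \<in> space M" "X k \<omega> = x" using that sub by auto
    then have "X (Suc k) \<omega> \<in> ccube x (rad x)" using X_Suc_ccube by auto
    then have "\<bar>X (Suc k) \<omega> $ i - x $ i\<bar> \<le> rad x" by (simp add: ccube_def)
    then show ?thesis by linarith
  qed
  have mult: "ennreal c * J 1 0 i (Suc k) A = (\<integral>\<^sup>+\<omega>. ennreal c * (L (Suc k) \<omega> * indicator A \<omega>) \<partial>M)" for c
    unfolding J_def by (subst nn_integral_cmult) (auto simp: \<phi>_def simp del: L.simps)
  have Jm: "J 1 0 i (Suc k) A = ennreal (measure Q A)"
    using emeasure_Q_H[OF AH, of i] by (simp add: Q.emeasure_eq_measure)
  have "ennreal ?l * J 1 0 i (Suc k) A \<le> J 0 1 i (Suc k) A"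
    unfolding mult unfolding J_def
  proof (rule nn_integral_mono)
    fix \<omega>
    show "ennreal ?l * (L (Suc k) \<omega> * indicator A \<omega>) \<le> L (Suc k) \<omega> * ennreal (\<phi> 0 1 i (X (Suc k) \<omega>)) * indicator A \<omega>"
      using bd[of \<omega>] by (cases "\<omega> \<in> A") (auto simp: \<phi>_def mult.commute[of "ennreal ?l"] intro!: mult_left_mono ennreal_leI simp del: L.simps)
  qed
  then have "ennreal (?l * measure Q A) \<le> ennreal ?I"
    using l by (simp add: I Jm ennreal_mult)
  then show "?l * measure Q A \<le> ?I" using I_nn by (simp add: ennreal_le_iff)
  have "J 0 1 i (Suc k) A \<le> ennreal ?u * J 1 0 i (Suc k) A"
    unfolding mult unfolding J_def
  proof (rule nn_integral_mono)
    fix \<omega>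
    show "L (Suc k) \<omega> * ennreal (\<phi> 0 1 i (X (Suc k) \<omega>)) * indicator A \<omega> \<le> ennreal ?u * (L (Suc k) \<omega> * indicator A \<omega>)"
      using bd[of \<omega>] by (cases "\<omega> \<in> A") (auto simp: \<phi>_def mult.commute[of "ennreal ?u"] intro!: mult_left_mono ennreal_leI simp del: L.simps)
  qed
  then have "ennreal ?I \<le> ennreal (?u * measure Q A)"
    using u by (simp add: I Jm ennreal_mult)
  then show "?I \<le> ?u * measure Q A" using u by (simp add: ennreal_le_iff)
qed

definition V :: "real \<Rightarrow> 'a \<Rightarrow> real ^ 'n" where
  "V t \<omega> = (\<chi> i. real_cond_exp Q (F t) (\<lambda>\<omega>. X_inf \<omega> $ i) \<omega>)"

lemma V_meas: "V t \<in> borel_measurable (F t)"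
  unfolding borel_measurable_vec_iff by (simp add: V_def)

lemma sigma_finite_subalgebra_Q:
  assumes "t \<in> {0..T}"
  shows "sigma_finite_subalgebra Q (F t)"
proof -
  interpret Q: prob_space Q by (rule prob_space_Q)
  interpret finite_measure_subalgebra Q "F t"
    by unfold_locales (use subalg_F[OF assms] in \<open>simp add: subalgebra_def\<close>)
  show ?thesis by unfold_locales
qed

text \<open>The sets \<open>C k x\<close> are known at time \<open>t\<close>, and the integral
  bounds hold on all their subsets in \<open>F t\<close>, which localises the conditional
  expectation. As there are only countably many pairs \<open>k\<close>, \<open>x\<close>, one null
  set serves for all.\<close>

lemma V_in_ccube:
  assumes t: "t \<in> {0..T}"
  shows "AE \<omega> in Q. \<forall>k. \<tau> k \<omega> < t \<and> t \<le> \<tau> (Suc k) \<omega> \<longrightarrow> V t \<omega> \<in> ccube (X k \<omega>) (rad (X k \<omega>))"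
proof -
  interpret Q: prob_space Q by (rule prob_space_Q)
  interpret Ft: sigma_finite_subalgebra Q "F t" by (rule sigma_finite_subalgebra_Q[OF t])
  define C where "C k x = {\<omega> \<in> space M. X k \<omega> = x} \<inter> before k t - before (Suc k) t" for k x
  have C: "C k x \<in> sets (F t)" for k x
  proof -
    have "{\<omega> \<in> space M. X k \<omega> = x} \<in> H_sets k"
      using measurable_sets[OF X_meas_H, of "{x}" k] sets_H[of k]
      by (simp add: space_H vimage_def Int_def conj_commute)
    then have "{\<omega> \<in> space M. X k \<omega> = x} \<inter> before k t \<in> sets (F t)" using t by (simp add: H_sets_def)
    then show ?thesis unfolding C_def using before_sets_F[OF t] by (rule sets.Diff)
  qed
  have bound: "AE \<omega> in Q. \<omega> \<in> C k x \<longrightarrow> \<bar>V t \<omega> $ i - x $ i\<bar> \<le> rad x" if x: "x \<in> Ob" for k x i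
  proof -
    have "AE \<omega> in Q. \<omega> \<in> C k x \<longrightarrow> V t \<omega> $ i \<le> x $ i + rad x"
      unfolding V_def vec_lambda_beta
      by (rule Ft.real_cond_exp_le_on[OF Q.finite_measure_axioms integrable_X_inf C])
         (rule integral_X_inf_bounds(2)[OF t _ _ x], auto simp: C_def)
    moreover have "AE \<omega> in Q. \<omega> \<in> C k x \<longrightarrow> x $ i - rad x \<le> V t \<omega> $ i"
      unfolding V_def vec_lambda_beta
      by (rule Ft.real_cond_exp_ge_on[OF Q.finite_measure_axioms integrable_X_inf C])
         (rule integral_X_inf_bounds(1)[OF t _ _ x], auto simp: C_def)
    ultimately show ?thesis by eventually_elim auto
  qed
  have "AE \<omega> in Q. \<forall>k. \<forall>x\<in>X k ` space M. \<omega> \<in> C k x \<longrightarrow> V t \<omega> \<in> ccube x (rad x)"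
    unfolding AE_all_countable AE_ball_countable[OF countable_X]
  proof (intro allI ballI)
    fix k x assume "x \<in> X k ` space M"
    then have "x \<in> Ob" using X_in by auto
    then have "AE \<omega> in Q. \<forall>i. \<omega> \<in> C k x \<longrightarrow> \<bar>V t \<omega> $ i - x $ i\<bar> \<le> rad x"
      unfolding AE_all_countable using bound by blast
    then show "AE \<omega> in Q. \<omega> \<in> C k x \<longrightarrow> V t \<omega> \<in> ccube x (rad x)"
      by eventually_elim (auto simp: ccube_def)
  qed
  moreover have "AE \<omega> in Q. \<omega> \<in> space M" using AE_space[of Q] by simp
  ultimately show ?thesis
  proof eventually_elim
    case (elim \<omega>)
    show ?case
    proof (intro allI impI)
      fix k assume "\<tau> k \<omega> < t \<and> t \<le> \<tau> (Suc k) \<omega>"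
      then have "\<omega> \<in> C k (X k \<omega>)" using elim(2) by (auto simp: C_def before_def)
      then show "V t \<omega> \<in> ccube (X k \<omega>) (rad (X k \<omega>))" using elim by blast
    qed
  qed
qed

lemma time_between:
  assumes \<omega>: "\<omega> \<in> space M" and t: "t \<in> {0..T}"
  obtains k where "\<tau> k \<omega> < t" "t \<le> \<tau> (Suc k) \<omega>"
proof -
  obtain j where j: "\<tau> j \<omega> = T" using \<tau>_eventually_T[OF \<omega>] .
  define m where "m = (LEAST j. t \<le> \<tau> j \<omega>)"
  have m: "t \<le> \<tau> m \<omega>" unfolding m_def by (rule LeastI[of _ j]) (use j t in auto)
  have "m \<noteq> 0" using m t by (cases m) auto
  then obtain k where k: "m = Suc k" by (cases m) auto
  have "\<not> t \<le> \<tau> k \<omega>" using not_less_Least[of k "\<lambda>j. t \<le> \<tau> j \<omega>"] k m_def by auto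
  then show ?thesis using that[of k] m k by auto
qed

text \<open>Setting coordinate \<open>i\<close> to 0 leaves the positive orthant, so the complement
  is no farther away than that coordinate.\<close>

lemma rad_le_nth:
  assumes "x \<in> Ob"
  shows "rad x \<le> \<kappa> * x $ i"
proof -
  let ?y = "x - x $ i *\<^sub>R axis i 1"
  have "?y $ i = 0" by simp
  then have "?y \<in> - Ob" using Ob_pos[of ?y i] by fastforce
  then have "infdist x (- Ob) \<le> dist x ?y" by (rule infdist_le)
  also have "\<dots> = x $ i" using Ob_pos[OF assms, of i] by (simp add: dist_norm)
  finally show ?thesis using \<kappa>_pos by (simp add: rad_def)
qed

text \<open>Both coordinates differ from that of the centre by at most a fraction
  \<open>\<kappa>\<close> of it. The assumption on \<open>\<kappa>\<close> is a rearrangement of 1 +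
  \<kappa> \<le> (1 + \<epsilon>) (1 - \<kappa>).\<close>

lemma ratio_bounds:
  assumes x: "x \<in> Ob" and y: "y \<in> ccube x (rad x)" and z: "z \<in> ccube x (rad x)"
    and \<epsilon>: "\<epsilon> > 0" "\<kappa> * (2 + \<epsilon>) \<le> \<epsilon>"
  shows "1 / (1 + \<epsilon>) \<le> y $ i / z $ i" "y $ i / z $ i \<le> 1 + \<epsilon>"
proof -
  have xi: "0 < x $ i" by (rule Ob_pos[OF x])
  have le: "b \<le> (1 + \<epsilon>) * a" if "a \<ge> x $ i - rad x" "b \<le> x $ i + rad x" for a b
  proof -
    have "b \<le> x $ i + \<kappa> * x $ i" using that rad_le_nth[OF x, of i] by linarith
    also have "\<dots> \<le> (1 + \<epsilon>) * (x $ i - \<kappa> * x $ i)"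
      using mult_right_mono[OF \<epsilon>(2), of "x $ i"] xi by (simp add: algebra_simps)
    also have "\<dots> \<le> (1 + \<epsilon>) * a"
      using that rad_le_nth[OF x, of i] \<epsilon>(1) by (intro mult_left_mono) linarith+
    finally show ?thesis .
  qed
  have c: "ccube x (rad x) \<subseteq> Ob"
    using ccube_subset[OF x] ccube_mono[of "rad x" "2 * rad x" x] rad_nonneg[of x] by auto
  have pos: "0 < y $ i" "0 < z $ i" using y z c Ob_pos by auto
  have b: "\<bar>y $ i - x $ i\<bar> \<le> rad x" "\<bar>z $ i - x $ i\<bar> \<le> rad x" using y z by (auto simp: ccube_def)
  have "z $ i \<le> (1 + \<epsilon>) * y $ i" "y $ i \<le> (1 + \<epsilon>) * z $ i" using b by (intro le; linarith)+
  then show "1 / (1 + \<epsilon>) \<le> y $ i / z $ i" "y $ i / z $ i \<le> 1 + \<epsilon>"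
    using pos \<epsilon>(1) by (simp_all add: field_simps)
qed

lemma ex_consistent_price_system:
  assumes \<epsilon>: "\<epsilon> > 0" "\<kappa> * (2 + \<epsilon>) \<le> \<epsilon>"
  shows "\<exists>St Q. eps_cps M F T \<epsilon> S St Q \<and> (\<forall>t\<in>{0..T}. \<forall>\<omega>\<in>space M. St t \<omega> \<in> Ob)"
proof -
  interpret Q: prob_space Q by (rule prob_space_Q)
  define good where "good t \<omega> \<longleftrightarrow> V t \<omega> \<in> Ob \<and>
      (\<forall>i. 1 / (1 + \<epsilon>) \<le> V t \<omega> $ i / S t \<omega> $ i \<and> V t \<omega> $ i / S t \<omega> $ i \<le> 1 + \<epsilon>)" for t \<omega>
  \<comment> \<open>For fixed \<open>t\<close> this changes \<open>V t\<close> only on a null set; it makes the bounds hold for all \<open>t\<close> simultaneously.\<close>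
  define St where "St t \<omega> = (if good t \<omega> then V t \<omega> else S t \<omega>)" for t \<omega>
  have AE_St: "AE \<omega> in Q. St t \<omega> = V t \<omega>" if t: "t \<in> {0..T}" for t
  proof -
    have "AE \<omega> in Q. \<omega> \<in> space M" using AE_space[of Q] by simp
    with V_in_ccube[OF t] show ?thesis
    proof eventually_elim
      case (elim \<omega>)
      obtain k where k: "\<tau> k \<omega> < t" "t \<le> \<tau> (Suc k) \<omega>" using time_between[OF elim(2) t] .
      have Vc: "V t \<omega> \<in> ccube (X k \<omega>) (rad (X k \<omega>))" using elim k by blast
      have Sc: "S t \<omega> \<in> ccube (X k \<omega>) (rad (X k \<omega>))"
        using S_between_ccube[OF elim(2) k(1) _ k(2)] t by auto
      have "V t \<omega> \<in> Ob"
        using Vc ccube_subset[OF X_in[OF elim(2), of k]] rad_nonneg[of "X k \<omega>"]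
          ccube_mono[of "rad (X k \<omega>)" "2 * rad (X k \<omega>)" "X k \<omega>"] by auto
      then have "good t \<omega>"
        unfolding good_def using ratio_bounds[OF X_in[OF elim(2)] Vc Sc \<epsilon>] by blast
      then show ?case by (simp add: St_def)
    qed
  qed
  have St_meas: "St t \<in> borel_measurable (F t)" if t: "t \<in> {0..T}" for t
  proof -
    note [measurable] = V_meas[of t] S_adapted[OF t] borel_open[OF open_Ob]
    have "Measurable.pred (F t) (good t)" unfolding good_def[abs_def] by measurable
    then show ?thesis unfolding St_def[abs_def] by measurable
  qed
  have MQ: "f \<in> borel_measurable Q" if "t \<in> {0..T}" "f \<in> borel_measurable (F t)" for t and f :: "'a \<Rightarrow> real"
    using that subalg_F measurable_from_subalg[of M "F t"] by (auto simp: measurable_cong_sets[OF sets_Q refl])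
  have int_V: "integrable Q (\<lambda>\<omega>. V t \<omega> $ i)" if t: "t \<in> {0..T}" for t i
  proof -
    interpret Ft: sigma_finite_subalgebra Q "F t" by (rule sigma_finite_subalgebra_Q[OF t])
    show ?thesis unfolding V_def by (simp add: Ft.real_cond_exp_int(1)[OF integrable_X_inf])
  qed
  have int_St: "integrable Q (\<lambda>\<omega>. St t \<omega> $ i)" if t: "t \<in> {0..T}" for t i
  proof (rule integrable_cong_AE_imp[OF int_V[OF t]])
    show "(\<lambda>\<omega>. St t \<omega> $ i) \<in> borel_measurable Q"
      using St_meas[OF t] by (intro MQ[OF t]) measurable
    show "AE \<omega> in Q. V t \<omega> $ i = St t \<omega> $ i" using AE_St[OF t] by eventually_elim simp
  qed
  \<comment> \<open>Comparing every time with the terminal centre gives the martingale identity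
    between two times, since an event of the earlier sigma-algebra belongs to both.\<close>
  have mart: "(\<integral>\<omega>. indicator A \<omega> * St t \<omega> $ i \<partial>Q) = (\<integral>\<omega>. indicator A \<omega> * X_inf \<omega> $ i \<partial>Q)"
    if t: "t \<in> {0..T}" and A: "A \<in> sets (F t)" for t A i
  proof -
    interpret Ft: sigma_finite_subalgebra Q "F t" by (rule sigma_finite_subalgebra_Q[OF t])
    have "(\<integral>\<omega>. indicator A \<omega> * St t \<omega> $ i \<partial>Q) = (\<integral>\<omega>. indicator A \<omega> * V t \<omega> $ i \<partial>Q)"
    proof (rule integral_cong_AE)
      show "(\<lambda>\<omega>. indicator A \<omega> * St t \<omega> $ i) \<in> borel_measurable Q"
        "(\<lambda>\<omega>. indicator A \<omega> * V t \<omega> $ i) \<in> borel_measurable Q"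
        using A St_meas[OF t] V_meas[of t] by (auto intro!: MQ[OF t])
      show "AE \<omega> in Q. indicator A \<omega> * St t \<omega> $ i = indicator A \<omega> * V t \<omega> $ i"
        using AE_St[OF t] by eventually_elim simp
    qed
    also have "\<dots> = (\<integral>\<omega>. indicator A \<omega> * X_inf \<omega> $ i \<partial>Q)"
      using Ft.real_cond_exp_intA[OF integrable_X_inf A] by (simp add: set_lebesgue_integral_def V_def)
    finally show ?thesis .
  qed
  have "is_martingale Q F T St"
    unfolding is_martingale_def
  proof (intro conjI ballI allI impI)
    fix s t i A assume "0 \<le> s \<and> s \<le> t \<and> t \<le> T" "A \<in> sets (F s)"
    moreover from this have "A \<in> sets (F t)" using F_mono[of s t] by auto
    ultimately show "(\<integral>\<omega>. indicator A \<omega> * St t \<omega> $ i \<partial>Q) = (\<integral>\<omega>. indicator A \<omega> * St s \<omega> $ i \<partial>Q)"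
      using mart[of t A i] mart[of s A i] by auto
  qed (use St_meas int_St in auto)
  moreover have "1 / (1 + \<epsilon>) \<le> St t \<omega> $ i / S t \<omega> $ i \<and> St t \<omega> $ i / S t \<omega> $ i \<le> 1 + \<epsilon>"
    if "t \<in> {0..T}" "\<omega> \<in> space M" for t \<omega> i
  proof (cases "good t \<omega>")
    case True
    then show ?thesis by (simp add: St_def good_def)
  next
    case False
    have "0 < S t \<omega> $ i" by (intro Ob_pos S_in that)
    then show ?thesis using False \<epsilon>(1) by (simp add: St_def)
  qed
  moreover have "St t \<omega> \<in> Ob" if "t \<in> {0..T}" "\<omega> \<in> space M" for t \<omega>
    using S_in[OF that] by (simp add: St_def good_def)
  ultimately show ?thesis
    using equiv_prob_Q unfolding eps_cps_def
    by (intro exI[of _ St] exI[of _ Q]) (auto intro!: AE_I2)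
qed

end

section \<open>The set of the theorem and the first centre\<close>

lemma O_set_eq:
  "O_set \<delta> = {x :: real ^ 'n::finite. (\<forall>j. 0 < x $ j) \<and> (\<forall>j. x $ j < (1 - \<delta>) * (\<Sum>i\<in>UNIV. x $ i))}"
proof -
  have "Max (range (\<lambda>j. x $ j / (\<Sum>i\<in>UNIV. x $ i))) < 1 - \<delta> \<longleftrightarrow>
    (\<forall>j. x $ j < (1 - \<delta>) * (\<Sum>i\<in>UNIV. x $ i))" if "\<forall>j. 0 < x $ j" for x :: "real ^ 'n"
  proof -
    have "0 < (\<Sum>i\<in>UNIV. x $ i)" using that by (intro sum_pos) auto
    then show ?thesis by (subst Max_less_iff) (auto simp: pos_divide_less_eq)
  qed
  then show ?thesis unfolding O_set_def by blast
qed

lemma open_O_set: "open (O_set \<delta> :: (real ^ 'n::finite) set)"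
proof -
  have "O_set \<delta> = (\<Inter>j. {x :: real ^ 'n. 0 < x $ j} \<inter> {x. x $ j < (1 - \<delta>) * (\<Sum>i\<in>UNIV. x $ i)})"
    unfolding O_set_eq by auto
  also have "open \<dots>"
    by (intro open_INT ballI open_Int open_Collect_less continuous_intros) auto
  finally show ?thesis .
qed

text \<open>By the Lindelof property. The cover provides a first centre with countable range that is
  close to \<open>S 0\<close> relative to its own radius.\<close>

lemma ex_countable_cube_cover:
  fixes U :: "(real ^ 'n::finite) set"
  assumes "\<And>x. x \<in> U \<Longrightarrow> 0 < r x"
  obtains C where "countable C" "C \<subseteq> U" "U \<subseteq> (\<Union>c\<in>C. ocube c (r c))"
proof -
  let ?f = "\<lambda>c. ocube c (r c)"
  obtain F' where F': "F' \<subseteq> ?f ` U" "countable F'" "\<Union>F' = \<Union>(?f ` U)"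
    using Lindelof[of "?f ` U"] open_ocube by (metis (no_types, lifting) imageE)
  obtain C where C: "countable C" "C \<subseteq> U" "F' = ?f ` C"
    using F'(1,2) countable_subset_image[of F' ?f U] by blast
  have "x \<in> ?f x" if "x \<in> U" for x using assms[OF that] by (simp add: ocube_def)
  then have "U \<subseteq> \<Union>(?f ` U)" by blast
  then show ?thesis using that[OF C(1,2)] F'(3) C(3) by simp
qed

theorem theorem1:
  fixes M :: "'a measure" and F :: "real \<Rightarrow> 'a measure" and T \<delta> :: real
    and S :: "real \<Rightarrow> 'a \<Rightarrow> real ^ 'n::finite"
  assumes "T > 0"
    and "usual_filtered_space M F T"
    and "0 < \<delta>" and "\<delta> < 1"
    and "cont_adapted_process M F T (O_set \<delta>) S"
    and "cond_full_support M F T (O_set \<delta>) S"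
  shows "\<forall>\<epsilon>>0. \<exists>St Q. eps_cps M F T \<epsilon> S St Q \<and>
            (\<forall>t\<in>{0..T}. \<forall>\<omega>\<in>space M. St t \<omega> \<in> O_set \<delta>)"
proof (intro allI impI)
  fix \<epsilon> :: real assume \<epsilon>: "\<epsilon> > 0"
  interpret prob_space M using assms(2) by (simp add: usual_filtered_space_def)
  define Ob :: "(real ^ 'n) set" where "Ob = O_set \<delta>"
  \<comment> \<open>The first bound controls the variation of the radius over a cube, the second
    solves the ratio condition for \<open>\<kappa>\<close>.\<close>
  define \<kappa> where "\<kappa> = min (1 / (8 * real CARD('n))) (\<epsilon> / (2 + \<epsilon>))"
  have sub: "subalgebra M (F t)" if "t \<in> {0..T}" for t
    using assms(2) that by (simp add: usual_filtered_space_def)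
  have mono: "sets (F s) \<subseteq> sets (F t)" if "0 \<le> s" "s \<le> t" "t \<le> T" for s t
    using assms(2) that unfolding usual_filtered_space_def by blast
  have triv: "measure M A = 0 \<or> measure M A = 1" if "A \<in> sets (F 0)" for A
    using assms(2) that unfolding usual_filtered_space_def by blast
  have pos: "0 < x $ i" if "x \<in> Ob" for x i
    using that by (simp add: Ob_def O_set_def)
  have op: "open Ob" unfolding Ob_def by (rule open_O_set)
  have ne: "- Ob \<noteq> {}" using pos[of 0] by auto
  have \<kappa>: "\<kappa> > 0" using \<epsilon> by (simp add: \<kappa>_def)
  have \<kappa>1: "\<kappa> * (8 * real CARD('n)) \<le> 1"
  proof -
    have "\<kappa> * (8 * real CARD('n)) \<le> 1 / (8 * real CARD('n)) * (8 * real CARD('n))"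
      by (intro mult_right_mono) (auto simp: \<kappa>_def)
    then show ?thesis by simp
  qed
  have \<kappa>2: "\<kappa> * (2 + \<epsilon>) \<le> \<epsilon>"
  proof -
    have "\<kappa> * (2 + \<epsilon>) \<le> \<epsilon> / (2 + \<epsilon>) * (2 + \<epsilon>)"
      using \<epsilon> by (intro mult_right_mono) (auto simp: \<kappa>_def)
    then show ?thesis using \<epsilon> by simp
  qed
  define r where "r x = 3/4 * (\<kappa> * infdist x (- Ob))" for x
  have "0 < r x" if "x \<in> Ob" for x
    unfolding r_def using \<kappa> op ne that by (intro mult_pos_pos infdist_pos_not_in_closed) auto
  then obtain C where C: "countable C" "C \<subseteq> Ob" "Ob \<subseteq> (\<Union>c\<in>C. ocube c (r c))"
    by (rule ex_countable_cube_cover)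
  have S0: "S 0 \<in> borel_measurable (F 0)" and S0_in: "\<And>\<omega>. \<omega> \<in> space M \<Longrightarrow> S 0 \<omega> \<in> Ob"
    using assms(1,5) by (auto simp: cont_adapted_process_def Ob_def)
  obtain \<omega>0 where "\<omega>0 \<in> space M" using not_empty by auto
  then have "C \<noteq> {}" using S0_in[of \<omega>0] C(3) by auto
  define c where "c = from_nat_into C"
  have c_in: "c n \<in> C" for n unfolding c_def by (rule from_nat_into[OF \<open>C \<noteq> {}\<close>])
  \<comment> \<open>Taking the least index is a measurable choice of a cube containing the initial
    position.\<close>
  define n where "n \<omega> = (LEAST n. S 0 \<omega> \<in> ocube (c n) (r (c n)))" for \<omega>
  define X0 where "X0 \<omega> = c (n \<omega>)" for \<omega>
  have near: "S 0 \<omega> \<in> ocube (X0 \<omega>) (r (X0 \<omega>))" if "\<omega> \<in> space M" for \<omega>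
  proof -
    obtain y where "y \<in> C" "S 0 \<omega> \<in> ocube y (r y)" using S0_in[OF \<open>\<omega> \<in> space M\<close>] C(3) by auto
    moreover obtain m where "c m = y"
      using from_nat_into_surj[OF C(1) \<open>y \<in> C\<close>] by (auto simp: c_def)
    ultimately have "S 0 \<omega> \<in> ocube (c m) (r (c m))" by simp
    then show ?thesis unfolding X0_def n_def by (rule LeastI)
  qed
  have n_meas: "n \<in> measurable (F 0) (count_space UNIV)"
  proof -
    note [measurable] = S0 borel_open[OF open_ocube]
    show ?thesis unfolding n_def[abs_def] by measurable
  qed
  have X0_meas: "X0 \<in> borel_measurable (F 0)"
    unfolding X0_def[abs_def] using measurable_compose[OF n_meas, of c borel] by simp
  \<comment> \<open>One of the countably many values of the first centre has positive probability,
    hence probability 1 by triviality of \<open>F 0\<close>. So \<open>X0\<close> is almost surely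
    constant, which yields its integrability.\<close>
  have "\<exists>m. measure M {\<omega> \<in> space M. X0 \<omega> = c m} \<noteq> 0"
  proof (rule ccontr)
    assume *: "\<not> ?thesis"
    have "{\<omega> \<in> space M. X0 \<omega> = c m} \<in> null_sets M" for m
    proof
      have "X0 \<in> borel_measurable M" using X0_meas sub[of 0] assms(1) measurable_from_subalg by auto
      then show "{\<omega> \<in> space M. X0 \<omega> = c m} \<in> sets M" by measurable
      show "emeasure M {\<omega> \<in> space M. X0 \<omega> = c m} = 0" using * by (simp add: emeasure_eq_measure)
    qed
    then have "(\<Union>m. {\<omega> \<in> space M. X0 \<omega> = c m}) \<in> null_sets M" by (intro null_sets_UN)
    moreover have "(\<Union>m. {\<omega> \<in> space M. X0 \<omega> = c m}) = space M" by (auto simp: X0_def)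
    ultimately show False using emeasure_space_1 by auto
  qed
  then obtain m where m: "measure M {\<omega> \<in> space M. X0 \<omega> = c m} \<noteq> 0" ..
  have "{\<omega> \<in> space M. X0 \<omega> = c m} \<in> sets (F 0)"
    using measurable_sets[OF X0_meas, of "{c m}"] sub[of 0] assms(1)
    by (simp add: subalgebra_def vimage_def Int_def conj_commute)
  then have "measure M {\<omega> \<in> space M. X0 \<omega> = c m} = 1" using triv m by blast
  then have "AE \<omega> in M. \<omega> \<in> {\<omega> \<in> space M. X0 \<omega> = c m}" by (rule AE_prob_1)
  then have AE_X0: "AE \<omega> in M. X0 \<omega> = c m" by eventually_elim simp
  have X0_int: "(\<integral>\<^sup>+\<omega>. ennreal (X0 \<omega> $ i) \<partial>M) < \<infinity>" for i
  proof -
    have "(\<integral>\<^sup>+\<omega>. ennreal (X0 \<omega> $ i) \<partial>M) = (\<integral>\<^sup>+\<omega>. ennreal (c m $ i) \<partial>M)"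
      using AE_X0 by (intro nn_integral_cong_AE) auto
    also have "\<dots> < \<infinity>" by (simp add: emeasure_space_1)
    finally show ?thesis .
  qed
  interpret cfs_process M F T Ob S \<kappa> X0
  proof
    show "countable (X0 ` space M)" by (rule countable_subset[OF _ C(1)]) (auto simp: X0_def c_in)
    show "X0 \<omega> \<in> Ob" for \<omega> using c_in C(2) by (auto simp: X0_def)
    show "S 0 \<omega> \<in> ccube (X0 \<omega>) (3/4 * (\<kappa> * infdist (X0 \<omega>) (- Ob)))" if "\<omega> \<in> space M" for \<omega>
      using near[OF that] ocube_subset_ccube by (auto simp: r_def)
  qed (use assms sub mono pos op \<kappa> \<kappa>1 X0_meas X0_int in \<open>simp_all add: Ob_def\<close>)
  show "\<exists>St Q. eps_cps M F T \<epsilon> S St Q \<and> (\<forall>t\<in>{0..T}. \<forall>\<omega>\<in>space M. St t \<omega> \<in> O_set \<delta>)"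
    using ex_consistent_price_system[OF \<epsilon> \<kappa>2] by (simp add: Ob_def)
qed

end
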